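(* Assume objective regularity, i.e. $\nabla f,\nabla g$ are jointly Lipschitz in $(x,y)$ with constants $\ell_{f,1},\ell_{g,1}$; for every $x$, $g(x,\cdot)$ is $\rho_g$-strongly convex for some $\rho_g>0$; $f,g\in C^2$ with $\nabla^2f,\nabla^2g$ jointly Lipschitz in $(x,y)$ with constants $\ell_{f,2},\ell_{g,2}$; and for all $(x,y)$, $\|\nabla_xf(x,y)\|_2\le\ell_{f,0}$, $\|\nabla_yf(x,y)\|_2\le\ell_{f,0}$ and $\|\nabla_xg(x,y)\|_2\le\ell_{g,0}$. Let $\mu>0$, let $\eta\in(0,1/2)$ and the local Dikin constants $\rho_\psi^\eta,\ell_{\psi,1}^\eta,\ell_{\psi,2}^\eta,\ell_{f,0}^\eta,\ell_{f,1}^\eta,\ell_{f,2}^\eta,\lambda_\eta$ be as in the context, and let $\lambda_0\ge\max\{\lambda_\eta,2\ell_{f,1}^\eta/\rho_\psi^\eta\}$. Then there exist finite constants $\ell_{*,0}^\eta,\ell_{\lambda,0}^\eta,L_F^\eta,c_x^\eta$ such that the following hold. (i) For any $x_1,x_2\in\mathbb R^{d_x}$ and $\lambda_1,\lambda_2\ge\lambda_0$, $$\|y^\star_{\lambda_2,\mu}(x_2)-y^\star_{\lambda_1,\mu}(x_1)\|_{y^\star_{\lambda_1,\mu}(x_1)}\le\frac{2\ell_{f,0}^\eta}{\rho_\psi^\eta}\Bigl|\frac1{\lambda_2}-\frac1{\lambda_1}\Bigr|+\ell_{\lambda,0}^\eta\|x_2-x_1\|_2.$$ (ii) For any $x_1,x_2\in\mathbb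 R^{d_x}$, $\|y_\mu^\star(x_2)-y_\mu^\star(x_1)\|_{y_\mu^\star(x_1)}\le\ell_{*,0}^\eta\|x_2-x_1\|_2$. (iii) $F_\mu(x)=f(x,y_\mu^\star(x))$ is differentiable on $\mathbb R^{d_x}$, and for any $x_1,x_2\in\mathbb R^{d_x}$, $\|\nabla F_\mu(x_2)-\nabla F_\mu(x_1)\|_2\le L_F^\eta\|x_2-x_1\|_2$. (iv) Let $C^\star_{\lambda,\mu}(x)=\min_{y\in\operatorname{int}(Y)}L_{\lambda,\mu}(x,y)$. Then for every $x\in\mathbb R^{d_x}$ and every $\lambda\ge\lambda_0$, $\|\nabla F_\mu(x)-\nabla C^\star_{\lambda,\mu}(x)\|_2\le c_x^\eta/\lambda$.
   Context: Let $Y=\{y\in\mathbb R^{d_y}:Ay\le b\}$ be a compact full-dimensional polytope with nonempty interior, $a_i^\top$ ($i=1,\dots,m$) the rows of $A$, and $f,g:\mathbb R^{d_x}\times\mathbb R^{d_y}\to\mathbb R$. With $y^\star(x)=\arg\min_{y\in Y}g(x,y)$ one assumes $\inf_xf(x,y^\star(x))>-\infty$. Objective regularity: (A1) $\nabla f,\nabla g$ jointly Lipschitz with constants $\ell_{f,1},\ell_{g,1}$; (A2) $g(x,\cdot)$ is $\rho_g$-strongly convex for every $x$, $\rho_g>0$; (A3) $f,g\in C^2$ with $\nabla^2f,\nabla^2g$ jointly Lipschitz with constants $\ell_{f,2},\ell_{g,2}$; (A4) for all $(x,y)$, $\|\nabla_xf\|_2,\|\nabla_yf\|_2\le\ell_{f,0}$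 and $\|\nabla_xg\|_2\le\ell_{g,0}$. Barrier objects: $\phi(y)=-\sum_i\log(b_i-a_i^\top y)$ on $\operatorname{int}(Y)$; $\psi_\mu(x,y)=g(x,y)+\mu\phi(y)$; $y_\mu^\star(x)=\arg\min_{y\in\operatorname{int}(Y)}\psi_\mu(x,y)$; $\psi_\mu^\star(x)=\min_{\operatorname{int}(Y)}\psi_\mu(x,\cdot)$; $L_{\lambda,\mu}(x,y)=f(x,y)+\lambda(\psi_\mu(x,y)-\psi_\mu^\star(x))$; $y^\star_{\lambda,\mu}(x)\in\arg\min_{y\in\operatorname{int}(Y)}L_{\lambda,\mu}(x,y)$. For $c\in\operatorname{int}(Y)$: $H_c=\nabla^2\phi(c)$, $\|u\|_c^2=\langle H_cu,u\rangle$, $\|w\|_{c,*}^2=\langle H_c^{-1}w,w\rangle$, $\|M\|_{2\to c,*}=\sup_{\|u\|_2=1}\|Mu\|_{c,*}$, $\|M\|_{c\to c,*}=\sup_{\|u\|_c=1}\|Mu\|_{c,*}$. For $r>0$: $T_{r,\mu}(x)=\{y\in\operatorname{int}(Y):\|y-y_\mu^\star(x)\|_{y_\mu^\star(x)}\le r\}$, $T^\lambda_{r,\mu}(x)=\{y\in\operatorname{int}(Y):\|y-y^\star_{\lambda,\mu}(x)\|_{y^\star_{\lambda,\mu}(x)}\le r\}$. $\nabla^2_{xy}h\in\mathbb R^{d_y\times d_x}$ is the $x$-derivative of $\nabla_yh$. Local Dikin constants: $\rho_\psi^\eta>0$, $\ell_{\psi,1}^\eta,\ell_{\psi,2}^\eta,\ell_{f,0}^\eta,\ell_{f,1}^\eta,\ell_{f,2}^\eta,\lambda_\eta<\infty$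 are constants (depending on $\eta,\mu,Y$ and the regularity constants only) such that for all $x$, and for both $(c,\mathcal T)=(y_\mu^\star(x),T_{2\eta,\mu}(x))$ and $(c,\mathcal T)=(y^\star_{\lambda,\mu}(x),T^\lambda_{2\eta,\mu}(x))$ with any $\lambda\ge\lambda_\eta$, and all $y,y_1,y_2\in\mathcal T$: $\rho_\psi^\eta H_c\preceq\nabla^2_{yy}\psi_\mu(x,y)\preceq\ell_{\psi,1}^\eta H_c$; $\|\nabla^2_{xy}\psi_\mu(x,y)\|_{2\to c,*}\le\ell_{\psi,1}^\eta$; $\|\nabla^2_{yy}\psi_\mu(x,y_1)-\nabla^2_{yy}\psi_\mu(x,y_2)\|_{c\to c,*}$ and $\|\nabla^2_{xy}\psi_\mu(x,y_1)-\nabla^2_{xy}\psi_\mu(x,y_2)\|_{2\to c,*}$ are $\le\ell_{\psi,2}^\eta\|y_1-y_2\|_c$; $\|\nabla_yf(x,y)\|_{c,*}\le\ell_{f,0}^\eta$; $\|\nabla^2_{xy}f(x,y)\|_{2\to c,*}\le\ell_{f,1}^\eta$; $\|\nabla^2_{yy}f(x,y)\|_{c\to c,*}\le\ell_{f,1}^\eta$; differences of $\nabla^2_{xy}f,\nabla^2_{yy}f$ satisfy the analogous Lipschitz bounds with $\ell_{f,2}^\eta$.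
   Formalization: The constant λ_η is additionally required to be at least some threshold Λ>0 depending only on Y, μ, η and the regularity constants; for arbitrary λ_η satisfying the local Dikin bounds, (i) with coefficient 2ℓ_{f,0}^η/ρ_ψ^η can fail. *)

theory Defs
  imports "HOL-Analysis.Analysis"
begin

section \<open>First and second derivatives\<close>

text \<open>
  Second derivatives are kept as linear maps: the Hessian is the derivative of the gradient, and
  \<open>hess_xy h (x, y)\<close> is the \<open>x\<close>-derivative of \<open>\<nabla>\<^sub>y h\<close>, a linear map from the \<open>x\<close>-space to
  the \<open>y\<close>-space.
\<close>

definition grad :: "('a::euclidean_space \<Rightarrow> real) \<Rightarrow> 'a \<Rightarrow> 'a" where
  "grad h z = (THE D. GDERIV h z :> D)"

definition hess :: "('a::euclidean_space \<Rightarrow> real) \<Rightarrow> 'a \<Rightarrow> 'a \<Rightarrow> 'a" where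
  "hess h z = frechet_derivative (grad h) (at z)"

definition grad_x :: "('a::euclidean_space \<times> 'b::euclidean_space \<Rightarrow> real) \<Rightarrow> 'a \<Rightarrow> 'b \<Rightarrow> 'a" where
  "grad_x h x y = grad (\<lambda>x'. h (x', y)) x"

definition grad_y :: "('a::euclidean_space \<times> 'b::euclidean_space \<Rightarrow> real) \<Rightarrow> 'a \<Rightarrow> 'b \<Rightarrow> 'b" where
  "grad_y h x y = grad (\<lambda>y'. h (x, y')) y"

definition hess_xy ::
  "('a::euclidean_space \<times> 'b::euclidean_space \<Rightarrow> real) \<Rightarrow> 'a \<Rightarrow> 'b \<Rightarrow> 'a \<Rightarrow> 'b" where
  "hess_xy h x y = frechet_derivative (\<lambda>x'. grad_y h x' y) (at x)"

definition hess_yy ::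
  "('a::euclidean_space \<times> 'b::euclidean_space \<Rightarrow> real) \<Rightarrow> 'a \<Rightarrow> 'b \<Rightarrow> 'b \<Rightarrow> 'b" where
  "hess_yy h x y = hess (\<lambda>y'. h (x, y')) y"

definition C2 :: "('a::euclidean_space \<Rightarrow> real) \<Rightarrow> bool" where
  "C2 h \<longleftrightarrow> (\<forall>z. h differentiable (at z)) \<and> (\<forall>z. grad h differentiable (at z)) \<and>
     (\<forall>u. continuous_on UNIV (\<lambda>z. hess h z u))"

definition strongly_convex :: "real \<Rightarrow> ('a::real_normed_vector \<Rightarrow> real) \<Rightarrow> bool" where
  "strongly_convex \<rho> h \<longleftrightarrow> (\<forall>y1 y2. \<forall>t\<in>{0..1}.
     h (t *\<^sub>R y1 + (1 - t) *\<^sub>R y2)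
       \<le> t * h y1 + (1 - t) * h y2 - \<rho> / 2 * t * (1 - t) * (norm (y1 - y2))\<^sup>2)"

definition objective_regular ::
  "real \<Rightarrow> real \<Rightarrow> real \<Rightarrow> real \<Rightarrow> real \<Rightarrow> real \<Rightarrow> real \<Rightarrow>
   ('a::euclidean_space \<times> 'b::euclidean_space \<Rightarrow> real) \<Rightarrow> ('a \<times> 'b \<Rightarrow> real) \<Rightarrow> bool" where
  "objective_regular lf0 lf1 lf2 lg0 lg1 lg2 \<rho>g f g \<longleftrightarrow>
     C2 f \<and> C2 g \<and>
     lf1-lipschitz_on UNIV (grad f) \<and> lg1-lipschitz_on UNIV (grad g) \<and>
     \<rho>g > 0 \<and> (\<forall>x. strongly_convex \<rho>g (\<lambda>y. g (x, y))) \<and>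
     (\<forall>z1 z2. onorm (\<lambda>u. hess f z1 u - hess f z2 u) \<le> lf2 * norm (z1 - z2)) \<and>
     (\<forall>z1 z2. onorm (\<lambda>u. hess g z1 u - hess g z2 u) \<le> lg2 * norm (z1 - z2)) \<and>
     (\<forall>x y. norm (grad_x f x y) \<le> lf0 \<and> norm (grad_y f x y) \<le> lf0 \<and> norm (grad_x g x y) \<le> lg0)"


section \<open>Barrier objects\<close>

definition feasible :: "real^'dy^'m \<Rightarrow> real^'m \<Rightarrow> (real^'dy) set" where
  "feasible A b = {y. A *v y \<le> b}"

definition y_star ::
  "real^'dy^'m \<Rightarrow> real^'m \<Rightarrow> ((real^'dx) \<times> (real^'dy) \<Rightarrow> real) \<Rightarrow> real^'dx \<Rightarrow> real^'dy" where
  "y_star A b g x = arg_min_on (\<lambda>y. g (x, y)) (feasible A b)"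

definition barrier :: "real^'dy^'m \<Rightarrow> real^'m \<Rightarrow> real^'dy \<Rightarrow> real" where
  "barrier A b y = - (\<Sum>i\<in>UNIV. ln (b $ i - row i A \<bullet> y))"

definition psi ::
  "real^'dy^'m \<Rightarrow> real^'m \<Rightarrow> ((real^'dx) \<times> (real^'dy) \<Rightarrow> real) \<Rightarrow> real \<Rightarrow>
   (real^'dx) \<times> (real^'dy) \<Rightarrow> real" where
  "psi A b g \<mu> = (\<lambda>(x, y). g (x, y) + \<mu> * barrier A b y)"

definition y_mu ::
  "real^'dy^'m \<Rightarrow> real^'m \<Rightarrow> ((real^'dx) \<times> (real^'dy) \<Rightarrow> real) \<Rightarrow> real \<Rightarrow>
   real^'dx \<Rightarrow> real^'dy" where
  "y_mu A b g \<mu> x = arg_min_on (\<lambda>y. psi A b g \<mu> (x, y)) (interior (feasible A b))"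

text \<open>
  The minimal values are written as infima over the interior; they are attained because the
  barrier blows up at the boundary of the bounded feasible set.
\<close>

definition psi_star ::
  "real^'dy^'m \<Rightarrow> real^'m \<Rightarrow> ((real^'dx) \<times> (real^'dy) \<Rightarrow> real) \<Rightarrow> real \<Rightarrow>
   real^'dx \<Rightarrow> real" where
  "psi_star A b g \<mu> x = (INF y\<in>interior (feasible A b). psi A b g \<mu> (x, y))"

definition penalty ::
  "real^'dy^'m \<Rightarrow> real^'m \<Rightarrow> ((real^'dx) \<times> (real^'dy) \<Rightarrow> real) \<Rightarrow>
   ((real^'dx) \<times> (real^'dy) \<Rightarrow> real) \<Rightarrow> real \<Rightarrow> real \<Rightarrow> real^'dx \<Rightarrow> real^'dy \<Rightarrow> real" where
  "penalty A b f g \<mu> lam x y = f (x, y) + lam * (psi A b g \<mu> (x, y) - psi_star A b g \<mu> x)"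

text \<open>
  The minimizer \<open>y\<^sup>\<star>\<^sub>\<lambda>\<^sub>,\<^sub>\<mu>(x)\<close> of the penalty need not be unique for small \<open>\<lambda>\<close>;
  \<open>arg_min_on\<close> selects an arbitrary one.
\<close>

definition y_lam ::
  "real^'dy^'m \<Rightarrow> real^'m \<Rightarrow> ((real^'dx) \<times> (real^'dy) \<Rightarrow> real) \<Rightarrow>
   ((real^'dx) \<times> (real^'dy) \<Rightarrow> real) \<Rightarrow> real \<Rightarrow> real \<Rightarrow> real^'dx \<Rightarrow> real^'dy" where
  "y_lam A b f g \<mu> lam x = arg_min_on (penalty A b f g \<mu> lam x) (interior (feasible A b))"

definition C_star ::
  "real^'dy^'m \<Rightarrow> real^'m \<Rightarrow> ((real^'dx) \<times> (real^'dy) \<Rightarrow> real) \<Rightarrow>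
   ((real^'dx) \<times> (real^'dy) \<Rightarrow> real) \<Rightarrow> real \<Rightarrow> real \<Rightarrow> real^'dx \<Rightarrow> real" where
  "C_star A b f g \<mu> lam x = (INF y\<in>interior (feasible A b). penalty A b f g \<mu> lam x y)"

definition F_mu ::
  "real^'dy^'m \<Rightarrow> real^'m \<Rightarrow> ((real^'dx) \<times> (real^'dy) \<Rightarrow> real) \<Rightarrow>
   ((real^'dx) \<times> (real^'dy) \<Rightarrow> real) \<Rightarrow> real \<Rightarrow> real^'dx \<Rightarrow> real" where
  "F_mu A b f g \<mu> x = f (x, y_mu A b g \<mu> x)"


section \<open>Local norms and Dikin regions\<close>

definition lnorm :: "real^'dy^'m \<Rightarrow> real^'m \<Rightarrow> real^'dy \<Rightarrow> real^'dy \<Rightarrow> real" where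
  "lnorm A b c u = sqrt (hess (barrier A b) c u \<bullet> u)"

definition dnorm :: "real^'dy^'m \<Rightarrow> real^'m \<Rightarrow> real^'dy \<Rightarrow> real^'dy \<Rightarrow> real" where
  "dnorm A b c w = sqrt (inv (hess (barrier A b) c) w \<bullet> w)"

definition opnorm_2 ::
  "real^'dy^'m \<Rightarrow> real^'m \<Rightarrow> real^'dy \<Rightarrow> (real^'dx \<Rightarrow> real^'dy) \<Rightarrow> real" where
  "opnorm_2 A b c M = (SUP u\<in>{u. norm u = 1}. dnorm A b c (M u))"

definition opnorm_c ::
  "real^'dy^'m \<Rightarrow> real^'m \<Rightarrow> real^'dy \<Rightarrow> (real^'dy \<Rightarrow> real^'dy) \<Rightarrow> real" where
  "opnorm_c A b c M = (SUP u\<in>{u. lnorm A b c u = 1}. dnorm A b c (M u))"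

text \<open>
  With \<open>c = y_mu \<dots> x\<close> and \<open>c = y_lam \<dots> x\<close> this gives \<open>T\<^sub>r\<^sub>,\<^sub>\<mu>(x)\<close> and
  \<open>T\<^sup>\<lambda>\<^sub>r\<^sub>,\<^sub>\<mu>(x)\<close>, respectively.
\<close>

definition dikin :: "real^'dy^'m \<Rightarrow> real^'m \<Rightarrow> real \<Rightarrow> real^'dy \<Rightarrow> (real^'dy) set" where
  "dikin A b r c = {y \<in> interior (feasible A b). lnorm A b c (y - c) \<le> r}"

definition local_bounds ::
  "real^'dy^'m \<Rightarrow> real^'m \<Rightarrow> ((real^'dx) \<times> (real^'dy) \<Rightarrow> real) \<Rightarrow>
   ((real^'dx) \<times> (real^'dy) \<Rightarrow> real) \<Rightarrow> real \<Rightarrow>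
   real \<Rightarrow> real \<Rightarrow> real \<Rightarrow> real \<Rightarrow> real \<Rightarrow> real \<Rightarrow>
   real^'dx \<Rightarrow> real^'dy \<Rightarrow> (real^'dy) set \<Rightarrow> bool" where
  "local_bounds A b f g \<mu> \<rho>p lp1 lp2 Lf0 Lf1 Lf2 x c T \<longleftrightarrow>
     (\<forall>y\<in>T.
        (\<forall>u. \<rho>p * (hess (barrier A b) c u \<bullet> u) \<le> hess_yy (psi A b g \<mu>) x y u \<bullet> u \<and>
             hess_yy (psi A b g \<mu>) x y u \<bullet> u \<le> lp1 * (hess (barrier A b) c u \<bullet> u)) \<and>
        opnorm_2 A b c (hess_xy (psi A b g \<mu>) x y) \<le> lp1 \<and>
        dnorm A b c (grad_y f x y) \<le> Lf0 \<and>
        opnorm_2 A b c (hess_xy f x y) \<le> Lf1 \<and>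
        opnorm_c A b c (hess_yy f x y) \<le> Lf1) \<and>
     (\<forall>y1\<in>T. \<forall>y2\<in>T.
        opnorm_c A b c (\<lambda>u. hess_yy (psi A b g \<mu>) x y1 u - hess_yy (psi A b g \<mu>) x y2 u)
          \<le> lp2 * lnorm A b c (y1 - y2) \<and>
        opnorm_2 A b c (\<lambda>u. hess_xy (psi A b g \<mu>) x y1 u - hess_xy (psi A b g \<mu>) x y2 u)
          \<le> lp2 * lnorm A b c (y1 - y2) \<and>
        opnorm_c A b c (\<lambda>u. hess_yy f x y1 u - hess_yy f x y2 u)
          \<le> Lf2 * lnorm A b c (y1 - y2) \<and>
        opnorm_2 A b c (\<lambda>u. hess_xy f x y1 u - hess_xy f x y2 u)
          \<le> Lf2 * lnorm A b c (y1 - y2))"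

definition dikin_constants ::
  "real^'dy^'m \<Rightarrow> real^'m \<Rightarrow> ((real^'dx) \<times> (real^'dy) \<Rightarrow> real) \<Rightarrow>
   ((real^'dx) \<times> (real^'dy) \<Rightarrow> real) \<Rightarrow> real \<Rightarrow> real \<Rightarrow>
   real \<Rightarrow> real \<Rightarrow> real \<Rightarrow> real \<Rightarrow> real \<Rightarrow> real \<Rightarrow> real \<Rightarrow> bool" where
  "dikin_constants A b f g \<mu> \<eta> \<rho>p lp1 lp2 Lf0 Lf1 Lf2 lame \<longleftrightarrow>
     \<rho>p > 0 \<and>
     (\<forall>x. local_bounds A b f g \<mu> \<rho>p lp1 lp2 Lf0 Lf1 Lf2 x
            (y_mu A b g \<mu> x) (dikin A b (2 * \<eta>) (y_mu A b g \<mu> x))) \<and>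
     (\<forall>x. \<forall>lam\<ge>lame. local_bounds A b f g \<mu> \<rho>p lp1 lp2 Lf0 Lf1 Lf2 x
            (y_lam A b f g \<mu> lam x) (dikin A b (2 * \<eta>) (y_lam A b f g \<mu> lam x)))"

end

theory Submission
  imports Defs
begin

text \<open>
  Writing \<open>s = 1/\<lambda>\<close>, the penalised problem has the minimizers of \<open>g(x,\<cdot>) + s f(x,\<cdot>) + \<mu> \<phi>\<close>,
  and \<open>s = 0\<close> is the barrier problem itself. Let \<open>\<Lambda>\<close> be so large that \<open>s \<ell>\<^sub>f\<^sub>,\<^sub>1 \<le> \<rho>\<^sub>g\<close> whenever
  \<open>\<lambda> \<ge> \<Lambda>\<close>; then \<open>g + s f\<close> is still convex in \<open>y\<close>, and the barrier alone controls how far stationary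
  points move.

  The main estimate is \<open>stationary_stability\<close>: the local distance between two stationary points is
  at most linear in the changes of \<open>x\<close> and \<open>s\<close>, however large these are. It follows from the
  self-concordance inequality \<open>\<langle>\<nabla>\<phi>(y') - \<nabla>\<phi>(y), y' - y\<rangle> \<ge> d\<^sup>2 / (1 + d)\<close>, where \<open>d\<close> is the local norm of
  \<open>y' - y\<close> at \<open>y\<close>, because the Euclidean length of \<open>y' - y\<close> is bounded both by the diameter of the
  polytope and by the diameter times \<open>d\<close>. The first bound settles large \<open>d\<close>, the second small \<open>d\<close>. This
  is the Lipschitz estimate (ii) and the \<open>x\<close>-part of (i).

  The coefficient \<open>2 \<ell>\<^sub>f\<^sub>,\<^sub>0 / \<rho>\<^sub>\<psi>\<close> in (i) has to come from the Dikin constants, which are only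
  valid within radius \<open>2\<eta>\<close> of the centre. Let \<open>\<Lambda>\<close> also be large compared with
  \<open>\<ell>\<^sub>f\<^sub>,\<^sub>0 / (\<mu> \<eta>)\<close> times the diameter. By the stability estimate, the two minimizers at the same \<open>x\<close> are then
  always that close when \<open>\<lambda>\<^sub>1, \<lambda>\<^sub>2 \<ge> \<Lambda>\<close>, and the mean value theorem along the segment
  gives the sharp constant (\<open>dikin_sensitivity_s\<close>). Changing \<open>\<lambda>\<close> first and \<open>x\<close> afterwards costs a factor of at most \<open>2\<close> in the \<open>x\<close>-term, where the constant is free.

  For (iii), let \<open>v\<close> be the adjoint state, \<open>\<nabla>\<^sup>2\<^sub>y\<^sub>y\<psi> v = \<nabla>\<^sub>y f\<close> at \<open>y\<^sub>\<mu>(x)\<close>, and let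
  \<open>G = \<nabla>\<^sub>x f - (\<nabla>\<^sup>2\<^sub>x\<^sub>y g)\<^sup>T v\<close>. Testing the linearised stationarity condition with \<open>v\<close> gives
  \<open>|F(x') - F(x) - \<langle>G(x), x' - x\<rangle>| \<le> C \<parallel>x' - x\<parallel>\<^sup>2\<close> with \<open>C\<close> independent of \<open>x, x'\<close>. This single
  inequality gives differentiability, \<open>\<nabla>F = G\<close>, and the Lipschitz bound for \<open>G\<close>.

  For (iv), the envelope theorem gives
  \<open>\<nabla>C\<^sup>\<star>\<^sub>\<lambda> = \<nabla>\<^sub>x f(x, y\<^sub>\<lambda>) + \<lambda> (\<nabla>\<^sub>x g(x, y\<^sub>\<lambda>) - \<nabla>\<^sub>x g(x, y\<^sub>\<mu>))\<close>. The same linearisation, tested with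
  \<open>v + \<lambda> (y\<^sub>\<lambda> - y\<^sub>\<mu>)\<close>, shows that this vector is \<open>O(1/\<lambda>)\<close>, and the symmetry of the Hessian of \<open>g\<close>
  turns it into the bound on the difference of the gradients.
\<close>

section \<open>Calculus with gradients and Hessians\<close>

lemma grad_eqI:
  assumes "GDERIV h z :> D"
  shows "grad h z = D"
  unfolding grad_def
proof (rule the_equality)
  fix D' assume "GDERIV h z :> D'"
  then have "(\<lambda>u. u \<bullet> D') = (\<lambda>u. u \<bullet> D)"
    using assms unfolding gderiv_def by (rule has_derivative_unique)
  then show "D' = D"
    by (metis inner_commute vector_eq_ldot)
qed (fact assms)

lemma has_derivative_grad:
  assumes "h differentiable (at z)"
  shows "(h has_derivative (\<lambda>u. grad h z \<bullet> u)) (at z)"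
proof -
  obtain h' where h': "(h has_derivative h') (at z)"
    using assms by (auto simp: differentiable_def)
  then interpret h': bounded_linear h' by (rule has_derivative_bounded_linear)
  have "h' = (\<lambda>u. u \<bullet> adjoint h' 1)"
    using adjoint_works[OF h'.linear] by (auto simp: fun_eq_iff)
  then have G: "GDERIV h z :> adjoint h' 1"
    using h' by (simp add: gderiv_def)
  then show ?thesis
    using grad_eqI[OF G] by (simp add: gderiv_def inner_commute)
qed

lemma has_derivative_imp_grad_eq:
  assumes "(h has_derivative (\<lambda>u. D \<bullet> u)) (at z)"
  shows "grad h z = D"
  using assms by (intro grad_eqI) (simp add: gderiv_def inner_commute)

lemma has_derivative_partial_x:
  assumes "(h has_derivative h') (at (x, y))"
  shows "((\<lambda>x'. h (x', y)) has_derivative (\<lambda>u. h' (u, 0))) (at x)"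
  by (rule has_derivative_compose[where f = "\<lambda>x'. (x', y)" and g = h, OF _ assms])
     (auto intro!: derivative_eq_intros)

lemma has_derivative_partial_y:
  assumes "(h has_derivative h') (at (x, y))"
  shows "((\<lambda>y'. h (x, y')) has_derivative (\<lambda>u. h' (0, u))) (at y)"
  by (rule has_derivative_compose[where f = "\<lambda>y'. (x, y')" and g = h, OF _ assms])
     (auto intro!: derivative_eq_intros)

lemma grad_x_eq_fst:
  assumes "h differentiable (at (x, y))"
  shows "grad_x h x y = fst (grad h (x, y))"
  unfolding grad_x_def
  using has_derivative_partial_x[OF has_derivative_grad[OF assms]]
  by (intro has_derivative_imp_grad_eq) (simp add: inner_prod_def)

lemma grad_y_eq_snd:
  assumes "h differentiable (at (x, y))"
  shows "grad_y h x y = snd (grad h (x, y))"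
  unfolding grad_y_def
  using has_derivative_partial_y[OF has_derivative_grad[OF assms]]
  by (intro has_derivative_imp_grad_eq) (simp add: inner_prod_def)

lemma segment_mvt:
  fixes k :: "'a::real_normed_vector \<Rightarrow> real"
  assumes "\<And>t. 0 \<le> t \<Longrightarrow> t \<le> 1 \<Longrightarrow> (k has_derivative k' (p + t *\<^sub>R d)) (at (p + t *\<^sub>R d))"
  obtains t where "0 \<le> t" "t \<le> 1" "k (p + d) - k p = k' (p + t *\<^sub>R d) d"
proof -
  have "((\<lambda>t. k (p + t *\<^sub>R d)) has_derivative (\<lambda>s. k' (p + t *\<^sub>R d) (s *\<^sub>R d))) (at t)"
    if "0 \<le> t" "t \<le> 1" for t
    by (rule has_derivative_compose[where f = "\<lambda>t. p + t *\<^sub>R d" and g = k, OF _ assms[OF that]])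
       (auto intro!: derivative_eq_intros)
  then have "\<exists>t\<in>{0..1}. k (p + 1 *\<^sub>R d) - k (p + 0 *\<^sub>R d) = k' (p + t *\<^sub>R d) ((1 - 0) *\<^sub>R d)"
    by (intro mvt_very_simple) (auto intro: has_derivative_at_withinI)
  then show thesis using that by auto
qed

lemma gradient_taylor_bound:
  fixes h :: "'a::euclidean_space \<Rightarrow> real"
  assumes diff: "\<And>z. h differentiable (at z)" and lip: "L-lipschitz_on UNIV (grad h)"
  shows "\<bar>h z' - h z - grad h z \<bullet> (z' - z)\<bar> \<le> L * (norm (z' - z))\<^sup>2"
proof -
  define d where "d = z' - z"
  obtain t where t: "0 \<le> t" "t \<le> 1" "h (z + d) - h z = grad h (z + t *\<^sub>R d) \<bullet> d"
    using segment_mvt[of h "\<lambda>p u. grad h p \<bullet> u" z d] has_derivative_grad[OF diff] by auto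
  have L: "0 \<le> L" using lip by (rule lipschitz_on_nonneg)
  have "norm (grad h (z + t *\<^sub>R d) - grad h z) \<le> L * norm (t *\<^sub>R d)"
    using lipschitz_onD[OF lip, of "z + t *\<^sub>R d" z] by (simp add: dist_norm)
  also have "\<dots> \<le> L * norm d"
    using t L by (intro mult_left_mono) (auto intro: mult_left_le_one_le)
  finally have "norm (grad h (z + t *\<^sub>R d) - grad h z) * norm d \<le> L * norm d * norm d"
    by (intro mult_right_mono) auto
  then have "\<bar>(grad h (z + t *\<^sub>R d) - grad h z) \<bullet> d\<bar> \<le> L * (norm d)\<^sup>2"
    using Cauchy_Schwarz_ineq2[of "grad h (z + t *\<^sub>R d) - grad h z" d]
    by (simp add: power2_eq_square mult.assoc)
  then show ?thesis using t by (simp add: d_def inner_diff_left)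
qed

lemma has_derivative_hess:
  assumes "C2 h"
  shows "(grad h has_derivative hess h z) (at z)"
  using assms unfolding C2_def hess_def by (simp add: frechet_derivative_works)

lemma linear_hess: "C2 h \<Longrightarrow> linear (hess h z)"
  using has_derivative_hess has_derivative_linear by blast

lemma hess_diff_bound:
  assumes "C2 h" and lip: "\<And>z1 z2. onorm (\<lambda>u. hess h z1 u - hess h z2 u) \<le> L * norm (z1 - z2)"
  shows "norm (hess h z1 u - hess h z2 u) \<le> L * norm (z1 - z2) * norm u"
proof -
  have "bounded_linear (\<lambda>u. hess h z1 u - hess h z2 u)"
    using has_derivative_hess[OF \<open>C2 h\<close>] by (intro bounded_linear_sub) (auto dest: has_derivative_bounded_linear)
  from onorm[OF this, of u] have "norm (hess h z1 u - hess h z2 u) \<le> onorm (\<lambda>u. hess h z1 u - hess h z2 u) * norm u" .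
  also have "\<dots> \<le> L * norm (z1 - z2) * norm u"
    using lip by (intro mult_right_mono) auto
  finally show ?thesis .
qed

lemma hessian_taylor_bound:
  assumes "C2 h" and lip: "\<And>z1 z2. onorm (\<lambda>u. hess h z1 u - hess h z2 u) \<le> L * norm (z1 - z2)"
  shows "norm (grad h z' - grad h z - hess h z (z' - z)) \<le> L * (norm (z' - z))\<^sup>2"
proof -
  define d where "d = z' - z"
  define e where "e = grad h z' - grad h z - hess h z d"
  have der: "((\<lambda>z. grad h z \<bullet> e) has_derivative (\<lambda>u. hess h p u \<bullet> e)) (at p)" for p
    by (rule has_derivative_inner_left[OF has_derivative_hess[OF \<open>C2 h\<close>]])
  obtain t where t: "0 \<le> t" "t \<le> 1" "grad h (z + d) \<bullet> e - grad h z \<bullet> e = hess h (z + t *\<^sub>R d) d \<bullet> e"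
    using segment_mvt[of "\<lambda>z. grad h z \<bullet> e" "\<lambda>p u. hess h p u \<bullet> e" z d] der by auto
  have "e \<bullet> e = (hess h (z + t *\<^sub>R d) d - hess h z d) \<bullet> e"
    using t(3) by (simp add: e_def d_def algebra_simps)
  also have "\<dots> \<le> norm (hess h (z + t *\<^sub>R d) d - hess h z d) * norm e"
    by (rule norm_cauchy_schwarz)
  finally have 1: "norm e * norm e \<le> norm (hess h (z + t *\<^sub>R d) d - hess h z d) * norm e"
    by (simp add: dot_square_norm power2_eq_square)
  have "norm e \<le> norm (hess h (z + t *\<^sub>R d) d - hess h z d)"
  proof (cases "e = 0")
    case False
    then show ?thesis using 1 by (simp add: mult_le_cancel_right)
  qed simp
  also have "\<dots> \<le> L * norm (t *\<^sub>R d) * norm d"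
    using hess_diff_bound[OF assms, of "z + t *\<^sub>R d" d z] by simp
  also have "\<dots> = t * (L * norm d * norm d)" using t by simp
  also have "\<dots> \<le> L * norm d * norm d"
  proof (rule mult_left_le_one_le)
    show "0 \<le> L * norm d * norm d"
      using hess_diff_bound[OF assms, of z' d z] norm_ge_zero[of "hess h z' d - hess h z d"]
      unfolding d_def by linarith
  qed (use t in auto)
  finally show ?thesis by (simp add: e_def d_def power2_eq_square)
qed

lemma zero_if_le_all_multiples:
  fixes a c :: real
  assumes "\<And>t. 0 < t \<Longrightarrow> a \<le> c * t"
  shows "a \<le> 0"
proof (rule field_le_epsilon)
  fix e :: real assume "0 < e"
  have "a \<le> c * (e / (\<bar>c\<bar> + 1))" using \<open>0 < e\<close> by (intro assms) auto
  also have "\<dots> = c * e / (\<bar>c\<bar> + 1)" by simp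
  also have "\<dots> \<le> e"
  proof -
    have "c * e \<le> (\<bar>c\<bar> + 1) * e" using \<open>0 < e\<close> by (intro mult_right_mono) auto
    then show ?thesis by (simp add: pos_divide_le_eq mult.commute)
  qed
  finally show "a \<le> 0 + e" by simp
qed

text \<open>
  Difference quotients of the gradient are bounded by the Lipschitz constant, and the Hessian is their limit.
\<close>

lemma hess_bound:
  assumes "C2 h" and lip: "\<And>z1 z2. onorm (\<lambda>u. hess h z1 u - hess h z2 u) \<le> L' * norm (z1 - z2)"
    and "L-lipschitz_on UNIV (grad h)"
  shows "norm (hess h z u) \<le> L * norm u"
proof -
  have "norm (hess h z u) - L * norm u \<le> (L' * (norm u)\<^sup>2) * t" if "0 < t" for t
  proof -
    have "norm (hess h z (t *\<^sub>R u)) \<le> norm (grad h (z + t *\<^sub>R u) - grad h z) + L' * (norm (t *\<^sub>R u))\<^sup>2"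
      using hessian_taylor_bound[OF assms(1,2), of "z + t *\<^sub>R u" z]
        norm_triangle_sub[of "hess h z (t *\<^sub>R u)" "grad h (z + t *\<^sub>R u) - grad h z"]
      by (simp add: norm_minus_commute)
    also have "norm (grad h (z + t *\<^sub>R u) - grad h z) \<le> L * norm (t *\<^sub>R u)"
      using lipschitz_onD[OF assms(3), of "z + t *\<^sub>R u" z] by (simp add: dist_norm)
    finally have "t * norm (hess h z u) \<le> t * (L * norm u + L' * (norm u)\<^sup>2 * t)"
      using that linear_hess[OF assms(1)]
      by (simp add: linear_scale power_mult_distrib power2_eq_square algebra_simps)
    then show ?thesis using that by simp
  qed
  then have "norm (hess h z u) - L * norm u \<le> 0" by (rule zero_if_le_all_multiples)
  then show ?thesis by simp
qed

text \<open>
  The second difference of \<open>h\<close> over the parallelogram spanned by \<open>t u\<close> and \<open>t v\<close> is symmetric in \<open>u\<close> and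
  \<open>v\<close>, and a Lipschitz Hessian makes it equal to \<open>t\<^sup>2 \<langle>\<nabla>\<^sup>2h v, u\<rangle>\<close> up to \<open>O(t\<^sup>3)\<close>.
\<close>

lemma hess_symmetric:
  assumes "C2 h" and lip: "\<And>z1 z2. onorm (\<lambda>u. hess h z1 u - hess h z2 u) \<le> L * norm (z1 - z2)"
  shows "hess h z u \<bullet> v = hess h z v \<bullet> u"
proof -
  have main: "\<bar>(h (z + t *\<^sub>R u + t *\<^sub>R v) - h (z + t *\<^sub>R u) - h (z + t *\<^sub>R v) + h z) - t\<^sup>2 * (hess h z v \<bullet> u)\<bar>
      \<le> 2 * \<bar>L\<bar> * (norm u + norm v)\<^sup>2 * norm u * t ^ 3" if "0 < t" for t u v
  proof -
    have dh: "(h has_derivative (\<lambda>w. grad h p \<bullet> w)) (at p)" for p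
      using \<open>C2 h\<close> by (intro has_derivative_grad) (auto simp: C2_def)
    have der: "((\<lambda>p. h (p + t *\<^sub>R v) - h p) has_derivative (\<lambda>w. (grad h (p + t *\<^sub>R v) - grad h p) \<bullet> w)) (at p)" for p
      unfolding inner_diff_left
      by (rule has_derivative_diff[OF _ dh])
         (rule has_derivative_compose[where f = "\<lambda>p. p + t *\<^sub>R v" and g = h, OF _ dh],
          auto intro!: derivative_eq_intros)
    obtain s where s: "0 \<le> s" "s \<le> 1"
      "(h (z + t *\<^sub>R u + t *\<^sub>R v) - h (z + t *\<^sub>R u)) - (h (z + t *\<^sub>R v) - h z)
        = (grad h (z + s *\<^sub>R (t *\<^sub>R u) + t *\<^sub>R v) - grad h (z + s *\<^sub>R (t *\<^sub>R u))) \<bullet> (t *\<^sub>R u)"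
      using segment_mvt[of "\<lambda>p. h (p + t *\<^sub>R v) - h p" "\<lambda>p w. (grad h (p + t *\<^sub>R v) - grad h p) \<bullet> w" z "t *\<^sub>R u"] der
      by (auto simp: diff_diff_eq)
    define d where "d = s *\<^sub>R (t *\<^sub>R u)"
    have nd: "norm d \<le> t * norm u"
      using s \<open>0 < t\<close> by (simp add: d_def mult_left_le_one_le)
    have nd1: "norm d \<le> t * (norm u + norm v)"
      using nd \<open>0 < t\<close> by (smt (verit, best) mult_left_mono norm_ge_zero)
    have nd2: "norm (d + t *\<^sub>R v) \<le> t * (norm u + norm v)"
      using norm_triangle_ineq[of d "t *\<^sub>R v"] nd \<open>0 < t\<close> by (simp add: algebra_simps)
    have taylor: "norm (grad h (z + w) - grad h z - hess h z w) \<le> \<bar>L\<bar> * (t * (norm u + norm v))\<^sup>2"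
      if "norm w \<le> t * (norm u + norm v)" for w
    proof -
      have "norm (grad h (z + w) - grad h z - hess h z w) \<le> L * (norm w)\<^sup>2"
        using hessian_taylor_bound[OF assms, of "z + w" z] by simp
      also have "\<dots> \<le> \<bar>L\<bar> * (t * (norm u + norm v))\<^sup>2"
        using that by (intro mult_mono power_mono) auto
      finally show ?thesis .
    qed
    define e1 where "e1 = grad h (z + (d + t *\<^sub>R v)) - grad h z - hess h z (d + t *\<^sub>R v)"
    define e2 where "e2 = grad h (z + d) - grad h z - hess h z d"
    have lin: "hess h z (d + t *\<^sub>R v) = hess h z d + t *\<^sub>R hess h z v"
      using linear_hess[OF \<open>C2 h\<close>] by (simp add: linear_add linear_scale)
    have eq: "(grad h (z + d + t *\<^sub>R v) - grad h (z + d)) = t *\<^sub>R hess h z v + (e1 - e2)"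
      unfolding e1_def e2_def lin by (simp add: algebra_simps)
    have S: "(h (z + t *\<^sub>R u + t *\<^sub>R v) - h (z + t *\<^sub>R u) - h (z + t *\<^sub>R v) + h z) - t\<^sup>2 * (hess h z v \<bullet> u)
        = t * ((e1 - e2) \<bullet> u)"
      using s(3) unfolding d_def[symmetric] eq
      by (simp add: inner_add_left inner_diff_left algebra_simps power2_eq_square)
    have "\<bar>(e1 - e2) \<bullet> u\<bar> \<le> norm (e1 - e2) * norm u" by (rule Cauchy_Schwarz_ineq2)
    also have "\<dots> \<le> (2 * \<bar>L\<bar> * (t * (norm u + norm v))\<^sup>2) * norm u"
      using taylor[OF nd1] taylor[OF nd2] norm_triangle_ineq4[of e1 e2]
      unfolding e1_def[symmetric] e2_def[symmetric] by (intro mult_right_mono) auto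
    finally have "t * \<bar>(e1 - e2) \<bullet> u\<bar> \<le> t * ((2 * \<bar>L\<bar> * (t * (norm u + norm v))\<^sup>2) * norm u)"
      using \<open>0 < t\<close> by (intro mult_left_mono) auto
    then show ?thesis
      unfolding S using \<open>0 < t\<close>
      by (simp only: abs_mult abs_of_pos power_mult_distrib power2_eq_square power3_eq_cube mult_ac)
  qed
  define K where "K = 2 * \<bar>L\<bar> * (norm u + norm v)\<^sup>2 * norm u + 2 * \<bar>L\<bar> * (norm v + norm u)\<^sup>2 * norm v"
  have "\<bar>hess h z u \<bullet> v - hess h z v \<bullet> u\<bar> \<le> K * t" if "0 < t" for t
  proof -
    have "t\<^sup>2 * \<bar>hess h z u \<bullet> v - hess h z v \<bullet> u\<bar> = \<bar>t\<^sup>2 * (hess h z u \<bullet> v) - t\<^sup>2 * (hess h z v \<bullet> u)\<bar>"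
      by (metis abs_mult abs_power2 right_diff_distrib)
    also have "\<dots> \<le> K * t ^ 3"
      using main[OF that, of u v] main[OF that, of v u] unfolding K_def
      by (simp add: add.commute add.left_commute ring_distribs)
    finally have "t\<^sup>2 * \<bar>hess h z u \<bullet> v - hess h z v \<bullet> u\<bar> \<le> t\<^sup>2 * (K * t)"
      by (simp add: power2_eq_square power3_eq_cube mult_ac)
    then show ?thesis using that by simp
  qed
  then have "\<bar>hess h z u \<bullet> v - hess h z v \<bullet> u\<bar> \<le> 0" by (rule zero_if_le_all_multiples)
  then show ?thesis by simp
qed

text \<open>
  Letting \<open>t\<close> tend to \<open>0\<close> in the convexity inequality yields the quadratic lower bound by the tangent;
  adding the bounds at both points yields monotonicity.
\<close>

lemma strongly_convex_gradient_monotone: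
  assumes "strongly_convex \<rho> h"
    and h1: "(h has_derivative (\<lambda>u. D1 \<bullet> u)) (at y1)" and h2: "(h has_derivative (\<lambda>u. D2 \<bullet> u)) (at y2)"
  shows "\<rho> * (norm (y2 - y1))\<^sup>2 \<le> (D2 - D1) \<bullet> (y2 - y1)"
proof -
  have above: "h y + D \<bullet> (y' - y) + \<rho> / 2 * (norm (y' - y))\<^sup>2 \<le> h y'"
    if D: "(h has_derivative (\<lambda>u. D \<bullet> u)) (at y)" for y y' D
  proof -
    define c where "c = \<rho> / 2 * (norm (y' - y))\<^sup>2"
    have "((\<lambda>t. h (y + t *\<^sub>R (y' - y))) has_derivative (\<lambda>t. D \<bullet> (t *\<^sub>R (y' - y)))) (at 0)"
      by (rule has_derivative_compose[where f = "\<lambda>t. y + t *\<^sub>R (y' - y)" and g = h])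
         (use D in \<open>auto intro!: derivative_eq_intros\<close>)
    then have "((\<lambda>t. h (y + t *\<^sub>R (y' - y))) has_real_derivative D \<bullet> (y' - y)) (at 0)"
      by (simp add: has_field_derivative_def mult_commute_abs)
    then have "((\<lambda>t. (h (y + t *\<^sub>R (y' - y)) - h y) / t) \<longlongrightarrow> D \<bullet> (y' - y)) (at_right 0)"
      by (auto simp: has_field_derivative_iff intro: tendsto_mono at_le)
    moreover have "((\<lambda>t. h y' - h y - c * (1 - t)) \<longlongrightarrow> h y' - h y - c * (1 - 0)) (at_right 0)"
      by (intro tendsto_intros)
    moreover have "\<forall>\<^sub>F t in at_right (0::real). (h (y + t *\<^sub>R (y' - y)) - h y) / t \<le> h y' - h y - c * (1 - t)"
    proof (rule eventually_at_rightI[of 0 1])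
      fix t :: real assume t: "t \<in> {0<..<1}"
      have "h (t *\<^sub>R y' + (1 - t) *\<^sub>R y) \<le> t * h y' + (1 - t) * h y - \<rho> / 2 * t * (1 - t) * (norm (y' - y))\<^sup>2"
        using assms(1) t unfolding strongly_convex_def by auto
      then have "h (y + t *\<^sub>R (y' - y)) - h y \<le> t * (h y' - h y - c * (1 - t))"
        by (simp add: c_def algebra_simps)
      then show "(h (y + t *\<^sub>R (y' - y)) - h y) / t \<le> h y' - h y - c * (1 - t)"
        using t by (simp add: divide_le_eq mult.commute)
    qed simp
    ultimately have "D \<bullet> (y' - y) \<le> h y' - h y - c * (1 - 0)"
      by (intro tendsto_le[OF trivial_limit_at_right_real])
    then show ?thesis by (simp add: c_def)
  qed
  show ?thesis
    using above[OF h1, of y2] above[OF h2, of y1]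
    by (simp add: norm_minus_commute algebra_simps)
qed

lemma quadratic_remainder_has_derivative:
  fixes F :: "'a::euclidean_space \<Rightarrow> real"
  assumes "\<And>x'. \<bar>F x' - F x - G \<bullet> (x' - x)\<bar> \<le> C * (norm (x' - x))\<^sup>2"
  shows "(F has_derivative (\<lambda>u. G \<bullet> u)) (at x)"
proof (rule has_derivativeI)
  show "bounded_linear ((\<bullet>) G)" by (rule bounded_linear_inner_right)
  show "((\<lambda>y. (F y - F x - G \<bullet> (y - x)) /\<^sub>R norm (y - x)) \<longlongrightarrow> 0) (at x)"
  proof (rule Lim_null_comparison)
    show "\<forall>\<^sub>F y in at x. norm ((F y - F x - G \<bullet> (y - x)) /\<^sub>R norm (y - x)) \<le> C * norm (y - x)"
    proof (rule eventually_at_filter[THEN iffD2], rule always_eventually, intro allI impI)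
      fix y assume "y \<noteq> x"
      then show "norm ((F y - F x - G \<bullet> (y - x)) /\<^sub>R norm (y - x)) \<le> C * norm (y - x)"
        using assms[of y] by (simp add: divide_simps power2_eq_square mult.assoc)
    qed
    have "((\<lambda>y. C * norm (y - x)) \<longlongrightarrow> C * norm (x - x)) (at x)" by (intro tendsto_intros)
    then show "((\<lambda>y. C * norm (y - x)) \<longlongrightarrow> 0) (at x)" by simp
  qed
qed

text \<open>
  Comparing the expansions of \<open>F\<close> at \<open>x\<close> and at \<open>y\<close> in a third point \<open>y + w\<close> bounds
  \<open>\<langle>G x - G y, w\<rangle>\<close>; the best \<open>w\<close> of length \<open>\<parallel>x - y\<parallel>\<close> points along \<open>G x - G y\<close>. The remainders at distances
  \<open>\<parallel>x - y\<parallel>\<close>, \<open>\<parallel>x - y\<parallel>\<close> and at most \<open>2 \<parallel>x - y\<parallel>\<close> contribute the constant \<open>1 + 1 + 4 = 6\<close>.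
\<close>

lemma quadratic_remainder_lipschitz_gradient:
  fixes F :: "'a::euclidean_space \<Rightarrow> real"
  assumes rem: "\<And>x x'. \<bar>F x' - F x - G x \<bullet> (x' - x)\<bar> \<le> C * (norm (x' - x))\<^sup>2"
  shows "norm (G x - G y) \<le> 6 * C * norm (x - y)"
proof (cases "G x = G y")
  case True
  have "0 \<le> C * (norm (x - y))\<^sup>2"
    using rem[of x y] by linarith
  then show ?thesis using True by (cases "x = y") (auto simp: zero_le_mult_iff)
next
  case False
  define r where "r = norm (x - y)"
  define g where "g = G x - G y"
  have g: "norm g > 0" using False by (simp add: g_def)
  have "x \<noteq> y" using False by auto
  then have r: "r > 0" by (simp add: r_def)
  have C: "0 \<le> C" using rem[of x y] r by (smt (verit) mult_neg_pos r_def zero_less_power)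
  define w where "w = (r / norm g) *\<^sub>R g"
  have nw: "norm w = r" using g r by (simp add: w_def)
  have "\<bar>F (y + w) - F y - G y \<bullet> w\<bar> \<le> C * r\<^sup>2"
    using rem[of "y + w" y] nw by simp
  moreover have "\<bar>F y - F x - G x \<bullet> (y - x)\<bar> \<le> C * r\<^sup>2"
    using rem[of y x] by (simp add: r_def norm_minus_commute)
  moreover have "\<bar>F (y + w) - F x - G x \<bullet> (y + w - x)\<bar> \<le> C * (2 * r)\<^sup>2"
  proof -
    have "norm (y + w - x) \<le> norm w + norm (x - y)"
      by (metis add_diff_eq add.commute norm_minus_commute norm_triangle_ineq)
    then have "norm (y + w - x) \<le> 2 * r" by (simp add: nw r_def)
    then have "C * (norm (y + w - x))\<^sup>2 \<le> C * (2 * r)\<^sup>2"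
      using C by (intro mult_left_mono power_mono) auto
    then show ?thesis using rem[of "y + w" x] by linarith
  qed
  moreover have "G x \<bullet> (y + w - x) = G x \<bullet> (y - x) + G x \<bullet> w"
    by (simp add: algebra_simps)
  ultimately have "g \<bullet> w \<le> 6 * C * r\<^sup>2"
    by (simp add: g_def inner_diff_left power_mult_distrib abs_le_iff)
  moreover have "g \<bullet> w = r * norm g"
    using g by (simp add: w_def dot_square_norm power2_eq_square)
  ultimately have "r * norm g \<le> r * (6 * C * r)" by (simp add: power2_eq_square mult_ac)
  then show ?thesis using r by (simp add: g_def r_def)
qed

section \<open>The logarithmic barrier and its local norms\<close>

definition slack :: "real^'n^'m \<Rightarrow> real^'m \<Rightarrow> real^'n \<Rightarrow> 'm \<Rightarrow> real" where
  "slack A b y i = b $ i - row i A \<bullet> y"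

text \<open>
  The step \<open>u\<close> measured in units of the slacks at \<open>y\<close>. It factors the barrier Hessian,
  \<open>\<langle>H\<^sub>y u, w\<rangle> = \<langle>rel_step y u, rel_step y w\<rangle>\<close>, so that the local norm is the Euclidean norm of the
  relative step. Rows of \<open>A\<close> that vanish contribute \<open>0\<close>, whatever their slack.
\<close>

definition rel_step :: "real^'n^'m \<Rightarrow> real^'m \<Rightarrow> real^'n \<Rightarrow> real^'n \<Rightarrow> real^'m" where
  "rel_step A b y u = (\<chi> i. (row i A \<bullet> u) / slack A b y i)"

definition barrier_grad :: "real^'n^'m \<Rightarrow> real^'m \<Rightarrow> real^'n \<Rightarrow> real^'n" where
  "barrier_grad A b y = (\<Sum>i\<in>UNIV. (1 / slack A b y i) *\<^sub>R row i A)"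

locale bounded_polytope =
  fixes A :: "real^'n^'m" and b :: "real^'m"
  assumes compact_Y: "compact (feasible A b)" and interior_Y: "interior (feasible A b) \<noteq> {}"
begin

abbreviation (input) Y :: "(real^'n) set" where "Y \<equiv> feasible A b"
abbreviation (input) Yi :: "(real^'n) set" where "Yi \<equiv> interior (feasible A b)"
abbreviation (input) sl :: "real^'n \<Rightarrow> 'm \<Rightarrow> real" where "sl \<equiv> slack A b"
abbreviation (input) D :: real where "D \<equiv> diameter (feasible A b)"
abbreviation (input) H :: "real^'n \<Rightarrow> real^'n \<Rightarrow> real^'n" where "H \<equiv> hess (barrier A b)"

lemma feasible_iff_slack: "y \<in> Y \<longleftrightarrow> (\<forall>i. 0 \<le> sl y i)"
  by (simp add: feasible_def slack_def less_eq_vec_def matrix_vector_mul_component row_def)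

lemma slack_add: "sl (y + u) i = sl y i - row i A \<bullet> u"
  by (simp add: slack_def inner_add_right)

text \<open>
  A zero row with \<open>b\<^sub>i = 0\<close> has slack \<open>0\<close> everywhere without cutting anything off, so positivity can
  only be asked of the nonzero rows.
\<close>

lemma interior_iff_slack: "y \<in> Yi \<longleftrightarrow> (\<forall>i. row i A \<noteq> 0 \<longrightarrow> 0 < sl y i)"
proof
  assume "y \<in> Yi"
  then obtain e where e: "0 < e" "ball y e \<subseteq> Y" by (auto simp: mem_interior)
  show "\<forall>i. row i A \<noteq> 0 \<longrightarrow> 0 < sl y i"
  proof (intro allI impI)
    fix i assume a: "row i A \<noteq> 0"
    define u where "u = (e / (2 * norm (row i A))) *\<^sub>R row i A"
    have "norm u < e" using e a by (simp add: u_def)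
    then have "y + u \<in> Y" using e by (auto simp: subset_iff dist_norm)
    then have "0 \<le> sl y i - row i A \<bullet> u" by (simp add: feasible_iff_slack flip: slack_add)
    moreover have "0 < row i A \<bullet> u" using e a by (simp add: u_def)
    ultimately show "0 < sl y i" by linarith
  qed
next
  assume pos: "\<forall>i. row i A \<noteq> 0 \<longrightarrow> 0 < sl y i"
  define U where "U = (\<Inter>i\<in>{i. row i A \<noteq> 0}. {z. row i A \<bullet> z < b $ i})"
  have "open U" unfolding U_def by (intro open_INT) (auto intro: open_halfspace_lt)
  moreover have "U \<subseteq> Y"
  proof
    fix z assume z: "z \<in> U"
    obtain y0 where y0: "y0 \<in> Y" using interior_Y interior_subset by blast
    have "0 \<le> sl z i" for i
      using z y0[unfolded feasible_iff_slack, rule_format, of i]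
      by (cases "row i A = 0") (auto simp: U_def slack_def)
    then show "z \<in> Y" by (simp add: feasible_iff_slack)
  qed
  moreover have "y \<in> U" using pos by (auto simp: U_def slack_def)
  ultimately show "y \<in> Yi" using interior_maximal by blast
qed

lemma has_derivative_ln_slack:
  assumes "y \<in> Yi"
  shows "((\<lambda>y. ln (b $ i - row i A \<bullet> y)) has_derivative (\<lambda>u. - (1 / sl y i) * (row i A \<bullet> u))) (at y)"
proof (cases "row i A = 0")
  case False
  then have "0 < b $ i - row i A \<bullet> y" using assms by (simp add: interior_iff_slack slack_def)
  then show ?thesis
    by (auto intro!: derivative_eq_intros simp: slack_def divide_inverse)
qed auto

lemma has_derivative_barrier:
  assumes "y \<in> Yi"
  shows "(barrier A b has_derivative (\<lambda>u. barrier_grad A b y \<bullet> u)) (at y)"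
proof -
  have "(barrier A b has_derivative (\<lambda>u. - (\<Sum>i\<in>UNIV. - (1 / sl y i) * (row i A \<bullet> u)))) (at y)"
    unfolding barrier_def
    by (intro has_derivative_minus has_derivative_sum has_derivative_ln_slack assms)
  then show ?thesis by (simp add: barrier_grad_def inner_sum_left sum_negf)
qed

lemma has_derivative_barrier_grad:
  assumes "y \<in> Yi"
  shows "(barrier_grad A b has_derivative (\<lambda>u. \<Sum>i\<in>UNIV. ((row i A \<bullet> u) / (sl y i)\<^sup>2) *\<^sub>R row i A)) (at y)"
  unfolding barrier_grad_def
proof (intro has_derivative_sum)
  fix i
  show "((\<lambda>y. (1 / sl y i) *\<^sub>R row i A) has_derivative (\<lambda>u. ((row i A \<bullet> u) / (sl y i)\<^sup>2) *\<^sub>R row i A)) (at y)"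
  proof (cases "row i A = 0")
    case False
    then have "b $ i - row i A \<bullet> y \<noteq> 0" using assms by (fastforce simp: interior_iff_slack slack_def)
    then show ?thesis
      unfolding slack_def
      by (auto intro!: derivative_eq_intros simp: power2_eq_square field_simps)
  qed auto
qed

lemma grad_barrier: "y \<in> Yi \<Longrightarrow> grad (barrier A b) y = barrier_grad A b y"
  by (intro has_derivative_imp_grad_eq has_derivative_barrier)

lemma has_derivative_H:
  assumes "y \<in> Yi"
  shows "(barrier_grad A b has_derivative H y) (at y)"
proof -
  have "(grad (barrier A b) has_derivative (\<lambda>u. \<Sum>i\<in>UNIV. ((row i A \<bullet> u) / (sl y i)\<^sup>2) *\<^sub>R row i A)) (at y)"
    using has_derivative_barrier_grad[OF assms] _ assms
    by (rule has_derivative_transform_within_open) (auto simp: grad_barrier)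
  then have "H y = (\<lambda>u. \<Sum>i\<in>UNIV. ((row i A \<bullet> u) / (sl y i)\<^sup>2) *\<^sub>R row i A)"
    unfolding hess_def by (rule frechet_derivative_at[symmetric])
  then show ?thesis using has_derivative_barrier_grad[OF assms] by simp
qed

lemma linear_H: "y \<in> Yi \<Longrightarrow> linear (H y)"
  using has_derivative_H has_derivative_linear by blast

lemma linear_rel_step: "linear (rel_step A b y)"
  by (rule linearI) (auto simp: rel_step_def vec_eq_iff inner_add_right add_divide_distrib)

lemma H_inner:
  assumes "y \<in> Yi"
  shows "H y u \<bullet> w = rel_step A b y u \<bullet> rel_step A b y w"
proof -
  have "H y u = (\<Sum>i\<in>UNIV. ((row i A \<bullet> u) / (sl y i)\<^sup>2) *\<^sub>R row i A)"
    using has_derivative_unique[OF has_derivative_H[OF assms] has_derivative_barrier_grad[OF assms]] by simp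
  then show ?thesis
    unfolding inner_vec_def[of "rel_step A b y u"]
    by (simp add: inner_sum_left rel_step_def power2_eq_square)
qed

lemma lnorm_eq_norm_rel_step: "y \<in> Yi \<Longrightarrow> lnorm A b y u = norm (rel_step A b y u)"
  by (simp add: lnorm_def H_inner norm_eq_sqrt_inner)

lemma lnorm_power2: "y \<in> Yi \<Longrightarrow> (lnorm A b y u)\<^sup>2 = H y u \<bullet> u"
  by (simp add: lnorm_eq_norm_rel_step H_inner dot_square_norm)

lemma lnorm_nonneg: "y \<in> Yi \<Longrightarrow> 0 \<le> lnorm A b y u"
  by (simp add: lnorm_eq_norm_rel_step)

lemma lnorm_scaleR: "y \<in> Yi \<Longrightarrow> lnorm A b y (t *\<^sub>R u) = \<bar>t\<bar> * lnorm A b y u"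
  by (simp add: lnorm_eq_norm_rel_step linear_scale[OF linear_rel_step])

lemma lnorm_triangle: "y \<in> Yi \<Longrightarrow> lnorm A b y (u + w) \<le> lnorm A b y u + lnorm A b y w"
  by (simp add: lnorm_eq_norm_rel_step linear_add[OF linear_rel_step] norm_triangle_ineq)

text \<open>
  The estimates for the barrier are estimates in the relative step because slacks along a step change by the factor
  \<open>1 - t\<^sub>i\<close>, where \<open>t\<close> is the relative step.
\<close>

lemma slack_quotient:
  assumes "y \<in> Yi" "row i A \<noteq> 0"
  shows "sl y' i = sl y i * (1 - rel_step A b y (y' - y) $ i)"
proof -
  have "0 < sl y i" using assms by (simp add: interior_iff_slack)
  then show ?thesis by (simp add: rel_step_def slack_def inner_diff_right field_simps)
qed

lemma D_nonneg: "0 \<le> D"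
  using compact_Y by (intro diameter_ge_0 compact_imp_bounded)

lemma norm_diff_le_D: "y \<in> Yi \<Longrightarrow> y' \<in> Yi \<Longrightarrow> norm (y' - y) \<le> D"
  using diameter_bounded_bound[OF compact_imp_bounded[OF compact_Y], of y' y] interior_subset
  by (auto simp: dist_norm subset_iff)

text \<open>
  The open unit ball of the local norm around an interior point lies inside the polytope, so it cannot be longer
  than the diameter in any direction.
\<close>

lemma norm_le_lnorm:
  assumes "y \<in> Yi"
  shows "norm u \<le> D * lnorm A b y u"
proof (rule field_le_epsilon)
  define r where "r = lnorm A b y u"
  have r: "0 \<le> r" using assms by (simp add: r_def lnorm_nonneg)
  have unit: "norm u \<le> D * k" if k: "r < k" for k
  proof -
    have "0 < k" using r k by simp
    have "y + (1 / k) *\<^sub>R u \<in> Yi"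
      unfolding interior_iff_slack
    proof (intro allI impI)
      fix i assume a: "row i A \<noteq> 0"
      have "\<bar>rel_step A b y ((1 / k) *\<^sub>R u) $ i\<bar> \<le> lnorm A b y ((1 / k) *\<^sub>R u)"
        using assms by (simp add: lnorm_eq_norm_rel_step component_le_norm_cart)
      also have "\<dots> < 1"
        using assms k \<open>0 < k\<close> by (simp add: lnorm_scaleR r_def)
      finally have "0 < 1 - rel_step A b y ((1 / k) *\<^sub>R u) $ i" by simp
      then show "0 < sl (y + (1 / k) *\<^sub>R u) i"
        using slack_quotient[OF assms a, of "y + (1 / k) *\<^sub>R u"] assms a
        by (simp add: interior_iff_slack)
    qed
    from norm_diff_le_D[OF assms this] show ?thesis
      using \<open>0 < k\<close> by (simp add: pos_divide_le_eq)
  qed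
  fix e :: real assume "0 < e"
  have "norm u \<le> D * (r + e / (D + 1))"
    using \<open>0 < e\<close> D_nonneg by (intro unit) simp
  also have "\<dots> \<le> D * r + e"
    using \<open>0 < e\<close> D_nonneg by (simp add: distrib_left pos_divide_le_eq)
  finally show "norm u \<le> D * lnorm A b y u + e" by (simp add: r_def)
qed

text \<open>
  Moving the centre from \<open>c\<close> to \<open>y\<close> multiplies each slack by at most \<open>1 + d\<close>, where \<open>d\<close> is the local
  distance.
\<close>

lemma lnorm_change_center:
  assumes c: "c \<in> Yi" and y: "y \<in> Yi"
  shows "lnorm A b c u \<le> (1 + lnorm A b c (y - c)) * lnorm A b y u"
proof -
  define d where "d = lnorm A b c (y - c)"
  have "0 \<le> d" using c by (simp add: d_def lnorm_nonneg)
  have "\<bar>rel_step A b c u $ i\<bar> \<le> \<bar>((1 + d) *\<^sub>R rel_step A b y u) $ i\<bar>" for i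
  proof (cases "row i A = 0")
    case False
    have s: "0 < sl c i" "0 < sl y i" using c y False by (auto simp: interior_iff_slack)
    have "\<bar>rel_step A b c (y - c) $ i\<bar> \<le> d"
      using c by (simp add: d_def lnorm_eq_norm_rel_step component_le_norm_cart)
    then have "sl y i \<le> (1 + d) * sl c i"
      using slack_quotient[OF c False, of y] s by (simp add: abs_le_iff mult.commute)
    then have "\<bar>row i A \<bullet> u\<bar> * sl y i \<le> \<bar>row i A \<bullet> u\<bar> * ((1 + d) * sl c i)"
      by (intro mult_left_mono) auto
    then show ?thesis
      using s \<open>0 \<le> d\<close> by (simp add: rel_step_def abs_mult abs_divide divide_simps mult_ac)
  qed (simp add: rel_step_def)
  then have "norm (rel_step A b c u) \<le> norm ((1 + d) *\<^sub>R rel_step A b y u)"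
    by (intro norm_le_componentwise_cart) auto
  then show ?thesis using c y \<open>0 \<le> d\<close> by (simp add: lnorm_eq_norm_rel_step d_def)
qed

text \<open>
  With \<open>t\<close> the relative step, the inverse slack changes by \<open>(1/s\<^sub>i) t\<^sub>i / (1 - t\<^sub>i)\<close>. This exact formula
  underlies both the monotonicity and the linearisation of the barrier gradient.
\<close>

lemma barrier_grad_diff_inner:
  assumes y: "y \<in> Yi" and y': "y' \<in> Yi"
  defines "t \<equiv> \<lambda>i. rel_step A b y (y' - y) $ i"
  shows "(barrier_grad A b y' - barrier_grad A b y) \<bullet> u = (\<Sum>i\<in>UNIV. rel_step A b y u $ i * (t i / (1 - t i)))"
    and "t i < 1"
proof -
  show t1: "t i < 1" for i
  proof (cases "row i A = 0")
    case False
    then have "0 < sl y i" "0 < sl y' i" using y y' by (auto simp: interior_iff_slack)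
    then show ?thesis
      using slack_quotient[OF y False, of y'] unfolding t_def by (simp add: zero_less_mult_iff)
  qed (simp add: t_def rel_step_def)
  have "(1 / sl y' i) * (row i A \<bullet> u) - (1 / sl y i) * (row i A \<bullet> u) = rel_step A b y u $ i * (t i / (1 - t i))" for i
  proof (cases "row i A = 0")
    case False
    then have "0 < sl y i" "0 < sl y' i" using y y' by (auto simp: interior_iff_slack)
    moreover have "0 < 1 - t i" using t1[of i] by simp
    moreover have "sl y' i = sl y i * (1 - t i)" unfolding t_def by (rule slack_quotient[OF y False])
    ultimately show ?thesis by (simp add: rel_step_def) (simp add: field_simps)
  qed (simp add: rel_step_def)
  then show "(barrier_grad A b y' - barrier_grad A b y) \<bullet> u = (\<Sum>i\<in>UNIV. rel_step A b y u $ i * (t i / (1 - t i)))"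
    by (simp add: barrier_grad_def inner_diff_left inner_sum_left flip: sum_subtractf)
qed

text \<open>
  The self-concordant form of strong monotonicity. The bound is quadratic for small \<open>d\<close> and linear for large
  \<open>d\<close>, and it holds for any two interior points.
\<close>

lemma barrier_grad_monotone:
  assumes y: "y \<in> Yi" and y': "y' \<in> Yi"
  defines "d \<equiv> lnorm A b y (y' - y)"
  shows "d\<^sup>2 / (1 + d) \<le> (barrier_grad A b y' - barrier_grad A b y) \<bullet> (y' - y)"
proof -
  define t where "t i = rel_step A b y (y' - y) $ i" for i
  have d: "0 \<le> d" using y by (simp add: d_def lnorm_nonneg)
  have "d\<^sup>2 = (\<Sum>i\<in>UNIV. (t i)\<^sup>2)"
    unfolding d_def lnorm_eq_norm_rel_step[OF y] norm_eq_sqrt_inner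
    by (simp add: inner_vec_def sum_nonneg t_def power2_eq_square)
  then have "d\<^sup>2 / (1 + d) = (\<Sum>i\<in>UNIV. (t i)\<^sup>2 / (1 + d))" by (simp add: sum_divide_distrib)
  also have "\<dots> \<le> (\<Sum>i\<in>UNIV. t i * (t i / (1 - t i)))"
  proof (rule sum_mono)
    fix i
    have "t i < 1" unfolding t_def by (rule barrier_grad_diff_inner(2)[OF y y'])
    moreover have "\<bar>t i\<bar> \<le> d"
      unfolding t_def d_def lnorm_eq_norm_rel_step[OF y] by (rule component_le_norm_cart)
    ultimately have "(t i)\<^sup>2 / (1 + d) \<le> (t i)\<^sup>2 / (1 - t i)"
      by (intro divide_left_mono mult_pos_pos) (use d in auto)
    then show "(t i)\<^sup>2 / (1 + d) \<le> t i * (t i / (1 - t i))" by (simp add: power2_eq_square)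
  qed
  also have "\<dots> = (barrier_grad A b y' - barrier_grad A b y) \<bullet> (y' - y)"
    unfolding barrier_grad_diff_inner(1)[OF y y'] t_def ..
  finally show ?thesis .
qed

text \<open>
  The linearisation error in coordinate \<open>i\<close> is \<open>t\<^sub>i\<^sup>2 / (1 - t\<^sub>i)\<close>, at most \<open>2 t\<^sub>i\<^sup>2\<close> within local
  distance \<open>1/2\<close>.
\<close>

lemma barrier_grad_linearization:
  assumes y: "y \<in> Yi" and y': "y' \<in> Yi"
  defines "d \<equiv> lnorm A b y (y' - y)"
  assumes small: "d \<le> 1 / 2"
  shows "\<bar>(barrier_grad A b y' - barrier_grad A b y - H y (y' - y)) \<bullet> u\<bar> \<le> 2 * d\<^sup>2 * lnorm A b y u"
proof -
  define t where "t i = rel_step A b y (y' - y) $ i" for i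
  define w where "w i = rel_step A b y u $ i" for i
  have d: "0 \<le> d" using y by (simp add: d_def lnorm_nonneg)
  have td: "\<bar>t i\<bar> \<le> d" for i
    unfolding t_def d_def lnorm_eq_norm_rel_step[OF y] by (rule component_le_norm_cart)
  have wn: "\<bar>w i\<bar> \<le> lnorm A b y u" for i
    unfolding w_def lnorm_eq_norm_rel_step[OF y] by (rule component_le_norm_cart)
  have d2: "d\<^sup>2 = (\<Sum>i\<in>UNIV. (t i)\<^sup>2)"
    unfolding d_def lnorm_eq_norm_rel_step[OF y] norm_eq_sqrt_inner
    by (simp add: inner_vec_def sum_nonneg t_def power2_eq_square)
  have "(barrier_grad A b y' - barrier_grad A b y - H y (y' - y)) \<bullet> u
      = (\<Sum>i\<in>UNIV. w i * (t i / (1 - t i))) - (\<Sum>i\<in>UNIV. t i * w i)"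
    unfolding inner_diff_left[of _ "H y (y' - y)"] barrier_grad_diff_inner(1)[OF y y'] H_inner[OF y]
    by (simp add: inner_vec_def w_def t_def)
  also have "\<dots> = (\<Sum>i\<in>UNIV. w i * ((t i)\<^sup>2 / (1 - t i)))"
    unfolding sum_subtractf[symmetric]
  proof (rule sum.cong[OF refl])
    fix i
    have "1 - t i \<noteq> 0" using barrier_grad_diff_inner(2)[OF y y', of i] unfolding t_def by simp
    then show "w i * (t i / (1 - t i)) - t i * w i = w i * ((t i)\<^sup>2 / (1 - t i))"
      by (simp add: field_simps power2_eq_square)
  qed
  finally have eq: "(barrier_grad A b y' - barrier_grad A b y - H y (y' - y)) \<bullet> u = \<dots>" .
  have "\<bar>\<Sum>i\<in>UNIV. w i * ((t i)\<^sup>2 / (1 - t i))\<bar> \<le> (\<Sum>i\<in>UNIV. lnorm A b y u * (2 * (t i)\<^sup>2))"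
  proof (rule order_trans[OF sum_abs sum_mono])
    fix i
    have "1 / 2 \<le> 1 - t i" using td[of i] small by (simp add: abs_le_iff)
    then have "(t i)\<^sup>2 / (1 - t i) \<le> (t i)\<^sup>2 / (1 / 2)"
      by (intro divide_left_mono) auto
    then have "\<bar>w i\<bar> * ((t i)\<^sup>2 / (1 - t i)) \<le> lnorm A b y u * (2 * (t i)\<^sup>2)"
      using wn[of i] lnorm_nonneg[OF y] \<open>1 / 2 \<le> 1 - t i\<close> by (intro mult_mono) auto
    then show "\<bar>w i * ((t i)\<^sup>2 / (1 - t i))\<bar> \<le> lnorm A b y u * (2 * (t i)\<^sup>2)"
      using \<open>1 / 2 \<le> 1 - t i\<close> by (simp add: abs_mult abs_divide)
  qed
  also have "\<dots> = 2 * d\<^sup>2 * lnorm A b y u"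
    unfolding d2 by (simp add: sum_distrib_left sum_distrib_right mult_ac)
  finally show ?thesis by (simp add: eq)
qed

lemma H_bij:
  assumes "y \<in> Yi"
  shows "bij (H y)"
proof -
  have "inj (H y)"
  proof (subst linear_injective_0[OF linear_H[OF assms]], intro allI impI)
    fix u assume "H y u = 0"
    then have "lnorm A b y u = 0" by (simp add: lnorm_def)
    then show "u = 0" using norm_le_lnorm[OF assms, of u] by simp
  qed
  then show ?thesis
    using linear_injective_imp_surjective[OF linear_H[OF assms]] by (simp add: bij_def)
qed

lemma dnorm_H:
  assumes "y \<in> Yi"
  shows "dnorm A b y (H y p) = lnorm A b y p"
  using H_bij[OF assms] by (simp add: dnorm_def lnorm_def bij_is_inj inner_commute)

lemma inner_le_dnorm_lnorm:
  assumes "y \<in> Yi"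
  shows "\<bar>w \<bullet> u\<bar> \<le> dnorm A b y w * lnorm A b y u"
proof -
  obtain p where "w = H y p" using H_bij[OF assms] by (metis bij_pointE)
  then show ?thesis
    using Cauchy_Schwarz_ineq2[of "rel_step A b y p" "rel_step A b y u"] assms
    by (simp add: dnorm_H H_inner lnorm_eq_norm_rel_step)
qed

lemma dnorm_le_norm:
  assumes "y \<in> Yi"
  shows "dnorm A b y w \<le> D * norm w"
proof -
  obtain p where w: "w = H y p" using H_bij[OF assms] by (metis bij_pointE)
  have "(lnorm A b y p)\<^sup>2 = w \<bullet> p" by (simp add: w lnorm_power2 assms)
  also have "\<dots> \<le> norm w * norm p" by (rule norm_cauchy_schwarz)
  also have "\<dots> \<le> norm w * (D * lnorm A b y p)"
    by (intro mult_left_mono norm_le_lnorm assms) auto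
  finally have "lnorm A b y p * lnorm A b y p \<le> (D * norm w) * lnorm A b y p"
    by (simp add: power2_eq_square mult_ac)
  then have "lnorm A b y p \<le> D * norm w"
    using lnorm_nonneg[OF assms, of p] D_nonneg
    by (cases "lnorm A b y p = 0") (auto simp: mult_le_cancel_right)
  then show ?thesis by (simp add: w dnorm_H assms)
qed

lemma dnorm_nonneg: "y \<in> Yi \<Longrightarrow> 0 \<le> dnorm A b y w"
  using H_bij[of y] by (metis bij_pointE dnorm_H lnorm_nonneg)

text \<open>
  Since the operator norm is a supremum of reals, it bounds the form only once the set of values
  is known to be bounded above; this holds because the unit sphere of the local norm is bounded.
\<close>

lemma opnorm_c_quadratic_form:
  assumes c: "c \<in> Yi" and M: "linear M"
  shows "\<bar>M u \<bullet> u\<bar> \<le> opnorm_c A b c M * (lnorm A b c u)\<^sup>2"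
proof (cases "lnorm A b c u = 0")
  case True
  then have "u = 0" using norm_le_lnorm[OF c, of u] by simp
  then show ?thesis using True by simp
next
  case False
  define r where "r = lnorm A b c u"
  define e where "e = (1 / r) *\<^sub>R u"
  have r: "0 < r" using False lnorm_nonneg[OF c, of u] by (simp add: r_def)
  have e1: "lnorm A b c e = 1" using r by (simp add: e_def lnorm_scaleR c flip: r_def)
  have u: "u = r *\<^sub>R e" using r by (simp add: e_def)
  have bM: "bounded_linear M" using M by (simp add: linear_conv_bounded_linear)
  have "bdd_above ((\<lambda>u. dnorm A b c (M u)) ` {u. lnorm A b c u = 1})"
  proof (rule bdd_aboveI2)
    fix u assume "u \<in> {u. lnorm A b c u = 1}"
    then have "norm u \<le> D" using norm_le_lnorm[OF c, of u] by simp
    have "dnorm A b c (M u) \<le> D * norm (M u)" by (rule dnorm_le_norm[OF c])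
    also have "\<dots> \<le> D * (onorm M * norm u)" by (intro mult_left_mono onorm bM D_nonneg)
    also have "\<dots> \<le> D * (onorm M * D)"
      using \<open>norm u \<le> D\<close> by (intro mult_left_mono D_nonneg onorm_pos_le bM)
    finally show "dnorm A b c (M u) \<le> D * (onorm M * D)" .
  qed
  then have "dnorm A b c (M e) \<le> opnorm_c A b c M"
    unfolding opnorm_c_def using e1 by (intro cSUP_upper) auto
  then have "\<bar>M e \<bullet> e\<bar> \<le> opnorm_c A b c M"
    using inner_le_dnorm_lnorm[OF c, of "M e" e] e1 by simp
  then have "r\<^sup>2 * \<bar>M e \<bullet> e\<bar> \<le> r\<^sup>2 * opnorm_c A b c M" by (intro mult_left_mono) auto
  moreover have "M u \<bullet> u = r\<^sup>2 * (M e \<bullet> e)"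
    by (simp add: u linear_scale[OF M] power2_eq_square)
  ultimately show ?thesis by (simp add: abs_mult r_def mult.commute)
qed

text \<open>
  The function \<open>exp (- q / \<mu>) \<Prod>\<^sub>i s\<^sub>i\<close>, with the product over the nonzero rows, is continuous on the
  compact polytope and positive exactly in its interior. Its maximizer is therefore interior, and there
  \<open>- \<mu>\<close> times its logarithm is \<open>q + \<mu> \<phi>\<close> up to a constant.
\<close>

lemma barrier_objective_attains_min:
  assumes "0 < \<mu>" and q: "continuous_on Y q"
  shows "\<exists>y\<in>Yi. \<forall>z\<in>Yi. q y + \<mu> * barrier A b y \<le> q z + \<mu> * barrier A b z"
proof -
  define I where "I = {i. row i A \<noteq> 0}"
  define E where "E y = exp (- q y / \<mu>) * (\<Prod>i\<in>I. sl y i)" for y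
  \<comment> \<open>minus the barrier terms of the zero rows, which do not depend on the point\<close>
  define k where "k = (\<Sum>i\<in>-I. ln (b $ i))"
  have "continuous_on Y E"
    unfolding E_def slack_def using q \<open>0 < \<mu>\<close> by (intro continuous_intros) auto
  moreover have "Y \<noteq> {}" using interior_Y interior_subset by blast
  ultimately obtain y where y: "y \<in> Y" "\<And>z. z \<in> Y \<Longrightarrow> E z \<le> E y"
    using continuous_attains_sup[OF compact_Y] by blast
  have pos: "0 < E z" if "z \<in> Yi" for z
    unfolding E_def using that by (intro mult_pos_pos prod_pos) (auto simp: I_def interior_iff_slack)
  obtain y0 where "y0 \<in> Yi" using interior_Y by blast
  then have "0 < E y" using pos y(2) interior_subset by (metis less_le_trans subsetD)
  then have "sl y i \<noteq> 0" if "i \<in> I" for i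
    using that by (auto simp: E_def zero_less_mult_iff dest!: less_imp_neq)
  then have yi: "y \<in> Yi"
    using y(1) by (auto simp: interior_iff_slack feasible_iff_slack I_def less_le)
  have E: "q z + \<mu> * barrier A b z = - \<mu> * ln (E z) - \<mu> * k" if "z \<in> Yi" for z
  proof -
    have s: "sl z i > 0" if "i \<in> I" for i using \<open>z \<in> Yi\<close> that by (auto simp: interior_iff_slack I_def)
    have ln_E: "ln (E z) = - q z / \<mu> + (\<Sum>i\<in>I. ln (sl z i))"
      unfolding E_def using s by (simp add: ln_mult_pos ln_prod prod_pos less_imp_neq[symmetric])
    have bar: "barrier A b z = - ((\<Sum>i\<in>I. ln (sl z i)) + k)"
    proof -
      have "(\<Sum>i\<in>UNIV. ln (sl z i)) = (\<Sum>i\<in>I. ln (sl z i)) + (\<Sum>i\<in>-I. ln (sl z i))"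
        by (subst sum.subset_diff[of I]) (auto simp: Compl_eq_Diff_UNIV)
      also have "(\<Sum>i\<in>-I. ln (sl z i)) = k"
        unfolding k_def by (intro sum.cong) (auto simp: I_def slack_def)
      finally show ?thesis by (simp add: barrier_def slack_def)
    qed
    show ?thesis using \<open>0 < \<mu>\<close> by (simp add: ln_E bar algebra_simps)
  qed
  have "q y + \<mu> * barrier A b y \<le> q z + \<mu> * barrier A b z" if "z \<in> Yi" for z
  proof -
    have "ln (E z) \<le> ln (E y)"
      using y(2)[of z] pos[OF that] that interior_subset by (metis ln_mono subsetD)
    then show ?thesis using \<open>0 < \<mu>\<close> by (simp add: E that yi)
  qed
  with yi show ?thesis by blast
qed

end

section \<open>Stationary points of the barrier problems\<close>

lemma arg_min_on_minimizes:
  fixes k :: "'a \<Rightarrow> 'b::linorder"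
  assumes "\<exists>y\<in>S. \<forall>z\<in>S. k y \<le> k z"
  shows "arg_min_on k S \<in> S \<and> (\<forall>z\<in>S. k (arg_min_on k S) \<le> k z)"
proof -
  have "\<exists>y. is_arg_min k (\<lambda>y. y \<in> S) y" using assms by (auto simp: is_arg_min_linorder)
  then have "is_arg_min k (\<lambda>y. y \<in> S) (arg_min_on k S)"
    unfolding arg_min_on_def arg_min_def by (rule someI_ex)
  then show ?thesis by (auto simp: is_arg_min_linorder)
qed

lemma INF_eq_value_at_minimizer:
  fixes k :: "'a \<Rightarrow> real"
  assumes "y \<in> S" "\<And>z. z \<in> S \<Longrightarrow> k y \<le> k z"
  shows "(INF z\<in>S. k z) = k y"
  using assms by (intro cInf_eq_minimum) auto

locale bilevel_barrier = bounded_polytope A b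
  for A :: "real^'n^'m" and b :: "real^'m" +
  fixes f g :: "(real^'k) \<times> (real^'n) \<Rightarrow> real"
    and \<mu> lf0 lf1 lf2 lg0 lg1 lg2 \<rho>g :: real
  assumes regular: "objective_regular lf0 lf1 lf2 lg0 lg1 lg2 \<rho>g f g" and mu_pos: "0 < \<mu>"
begin

abbreviation (input) fy :: "real^'k \<Rightarrow> real^'n \<Rightarrow> real^'n" where "fy x y \<equiv> snd (grad f (x, y))"
abbreviation (input) gy :: "real^'k \<Rightarrow> real^'n \<Rightarrow> real^'n" where "gy x y \<equiv> snd (grad g (x, y))"
abbreviation (input) fx :: "real^'k \<Rightarrow> real^'n \<Rightarrow> real^'k" where "fx x y \<equiv> fst (grad f (x, y))"
abbreviation (input) gx :: "real^'k \<Rightarrow> real^'n \<Rightarrow> real^'k" where "gx x y \<equiv> fst (grad g (x, y))"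

lemma C2_f: "C2 f" and C2_g: "C2 g"
  and lip_f: "lf1-lipschitz_on UNIV (grad f)" and lip_g: "lg1-lipschitz_on UNIV (grad g)"
  and rho_pos: "0 < \<rho>g"
  and sc_g: "strongly_convex \<rho>g (\<lambda>y. g (x, y))"
  and lip_hess_g: "onorm (\<lambda>u. hess g z1 u - hess g z2 u) \<le> lg2 * norm (z1 - z2)"
  using regular unfolding objective_regular_def by blast+

lemma diff_f: "f differentiable (at z)" and diff_g: "g differentiable (at z)"
  using C2_f C2_g unfolding C2_def by blast+

lemma norm_fx: "norm (fx x y) \<le> lf0" and norm_fy: "norm (fy x y) \<le> lf0"
  using regular by (auto simp: objective_regular_def grad_x_eq_fst diff_f grad_y_eq_snd)

lemma lf0_nonneg: "0 \<le> lf0" and lf1_nonneg: "0 \<le> lf1" and lg1_nonneg: "0 \<le> lg1"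
  using norm_fx[of undefined undefined] norm_ge_zero order_trans
    lipschitz_on_nonneg[OF lip_f] lipschitz_on_nonneg[OF lip_g] by blast+

lemma grad_f_lipschitz: "norm (grad f z' - grad f z) \<le> lf1 * norm (z' - z)"
  and grad_g_lipschitz: "norm (grad g z' - grad g z) \<le> lg1 * norm (z' - z)"
  using lipschitz_onD[OF lip_f, of z' z] lipschitz_onD[OF lip_g, of z' z] by (simp_all add: dist_norm)

lemma
  shows fx_lipschitz: "norm (fst (grad f z') - fst (grad f z)) \<le> lf1 * norm (z' - z)"
    and fy_lipschitz: "norm (snd (grad f z') - snd (grad f z)) \<le> lf1 * norm (z' - z)"
    and gx_lipschitz: "norm (fst (grad g z') - fst (grad g z)) \<le> lg1 * norm (z' - z)"
    and gy_lipschitz: "norm (snd (grad g z') - snd (grad g z)) \<le> lg1 * norm (z' - z)"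
proof -
  have "norm (fst p - fst q) \<le> norm (p - q)" "norm (snd p - snd q) \<le> norm (p - q)"
    for p q :: "(real^'k) \<times> (real^'n)"
    by (cases p; cases q; simp add: norm_fst_le norm_snd_le)+
  then show
    "norm (fst (grad f z') - fst (grad f z)) \<le> lf1 * norm (z' - z)"
    "norm (snd (grad f z') - snd (grad f z)) \<le> lf1 * norm (z' - z)"
    "norm (fst (grad g z') - fst (grad g z)) \<le> lg1 * norm (z' - z)"
    "norm (snd (grad g z') - snd (grad g z)) \<le> lg1 * norm (z' - z)"
    using grad_f_lipschitz grad_g_lipschitz order_trans by blast+
qed

lemma f_lipschitz: "\<bar>f z' - f z\<bar> \<le> 2 * lf0 * norm (z' - z)"
proof -
  obtain t where "f (z + (z' - z)) - f z = grad f (z + t *\<^sub>R (z' - z)) \<bullet> (z' - z)"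
    using segment_mvt[of f "\<lambda>p u. grad f p \<bullet> u" z "z' - z"] has_derivative_grad[OF diff_f] by metis
  moreover have "norm (grad f p) \<le> 2 * lf0" for p
    using norm_Pair_le[of "fst (grad f p)" "snd (grad f p)"] norm_fx[of "fst p" "snd p"] norm_fy[of "fst p" "snd p"]
    by simp
  ultimately show ?thesis
    using Cauchy_Schwarz_ineq2[of "grad f (z + t *\<^sub>R (z' - z))" "z' - z"]
      mult_right_mono[of "norm (grad f (z + t *\<^sub>R (z' - z)))" "2 * lf0" "norm (z' - z)"]
    by (smt (verit) add.commute diff_add_cancel norm_ge_zero)
qed

text \<open>
  Up to the factor \<open>\<lambda>\<close> and a term independent of \<open>y\<close>, this is the penalty with \<open>s = 1/\<lambda>\<close>; with \<open>s = 0\<close>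
  it is \<open>\<psi>\<^sub>\<mu>\<close>. One family thus covers both lower-level problems.
\<close>

definition objective :: "real \<Rightarrow> real^'k \<Rightarrow> real^'n \<Rightarrow> real" where
  "objective s x y = g (x, y) + s * f (x, y) + \<mu> * barrier A b y"

definition minimizer :: "real \<Rightarrow> real^'k \<Rightarrow> real^'n \<Rightarrow> bool" where
  "minimizer s x y \<longleftrightarrow> y \<in> Yi \<and> (\<forall>z\<in>Yi. objective s x y \<le> objective s x z)"

definition stationary :: "real \<Rightarrow> real^'k \<Rightarrow> real^'n \<Rightarrow> bool" where
  "stationary s x y \<longleftrightarrow> y \<in> Yi \<and> gy x y + s *\<^sub>R fy x y + \<mu> *\<^sub>R barrier_grad A b y = 0"

text \<open>
  For these weights the concavity that \<open>s f\<close> may have in \<open>y\<close> is absorbed by the strong convexity of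
  \<open>g\<close>.
\<close>

definition admissible :: "real \<Rightarrow> bool" where
  "admissible s \<longleftrightarrow> 0 \<le> s \<and> s * lf1 \<le> \<rho>g"

lemma continuous_partial:
  assumes "\<And>z. (h :: (real^'k) \<times> (real^'n) \<Rightarrow> real) differentiable (at z)"
  shows "continuous_on S (\<lambda>y. h (x, y))"
proof -
  have "continuous_on UNIV h"
    using assms by (intro differentiable_imp_continuous_on) (simp add: differentiable_on_def)
  then show ?thesis by (rule continuous_on_compose2) (auto intro!: continuous_intros)
qed

lemma minimizer_exists: "\<exists>y. minimizer s x y"
proof -
  have "continuous_on Y (\<lambda>y. g (x, y) + s * f (x, y))"
    by (intro continuous_intros continuous_partial diff_f diff_g)
  from barrier_objective_attains_min[OF mu_pos this] show ?thesis
    by (auto simp: minimizer_def objective_def)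
qed

lemma has_derivative_partial_grad_y:
  assumes "h differentiable (at (x, y))"
  shows "((\<lambda>y. h (x, y)) has_derivative (\<lambda>u. snd (grad h (x, y)) \<bullet> u)) (at y)"
  using has_derivative_partial_y[OF has_derivative_grad[OF assms]] by (simp add: inner_prod_def)

lemma minimizer_imp_stationary:
  assumes "minimizer s x y"
  shows "stationary s x y"
proof -
  have y: "y \<in> Yi" using assms by (simp add: minimizer_def)
  have "(objective s x has_derivative
      (\<lambda>u. (gy x y \<bullet> u + s * (fy x y \<bullet> u)) + \<mu> * (barrier_grad A b y \<bullet> u))) (at y)"
    unfolding objective_def
    by (intro has_derivative_add has_derivative_mult_right has_derivative_partial_grad_y
        has_derivative_barrier diff_f diff_g y)
  then have "(\<lambda>u. (gy x y \<bullet> u + s * (fy x y \<bullet> u)) + \<mu> * (barrier_grad A b y \<bullet> u)) = (\<lambda>v. 0)"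
    using assms by (intro differential_zero_maxmin[OF y open_interior]) (auto simp: minimizer_def)
  then have "(gy x y + s *\<^sub>R fy x y + \<mu> *\<^sub>R barrier_grad A b y) \<bullet> u = 0" for u
    by (auto simp: fun_eq_iff inner_add_left)
  then have "gy x y + s *\<^sub>R fy x y + \<mu> *\<^sub>R barrier_grad A b y = 0"
    by (metis inner_eq_zero_iff)
  then show ?thesis using y by (simp add: stationary_def)
qed

lemma gy_monotone: "\<rho>g * (norm (y2 - y1))\<^sup>2 \<le> (gy x y2 - gy x y1) \<bullet> (y2 - y1)"
  by (rule strongly_convex_gradient_monotone[OF sc_g[of x]])
     (intro has_derivative_partial_grad_y diff_g)+

lemma stationary_barrier_grad:
  "stationary s x y \<Longrightarrow> \<mu> *\<^sub>R barrier_grad A b y = - (gy x y + s *\<^sub>R fy x y)"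
  unfolding stationary_def eq_neg_iff_add_eq_0 by (simp add: add.commute)

text \<open>
  Subtracting the two stationarity conditions and using that \<open>g + s2 f\<close> has a monotone \<open>y\<close>-gradient leaves
  \<open>\<mu> \<langle>\<nabla>\<phi>(y2) - \<nabla>\<phi>(y1), y2 - y1\<rangle> \<le> \<parallel>w\<parallel> \<parallel>y2 - y1\<parallel>\<close>, where \<open>w\<close> is the change of the smooth
  gradient at the fixed point \<open>y1\<close>. The left-hand side is at least \<open>\<mu> d\<^sup>2 / (1 + d)\<close>.
\<close>

lemma stationary_stability:
  assumes st1: "stationary s1 x1 y1" and st2: "stationary s2 x2 y2" and s2: "admissible s2"
  shows "lnorm A b y1 (y2 - y1) \<le> 2 * D / \<mu> * ((lg1 + \<rho>g) * norm (x2 - x1) + lf0 * \<bar>s2 - s1\<bar>)"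
proof -
  define u where "u = y2 - y1"
  define d where "d = lnorm A b y1 u"
  define R where "R = (lg1 + \<rho>g) * norm (x2 - x1) + lf0 * \<bar>s2 - s1\<bar>"
  have y1: "y1 \<in> Yi" and y2: "y2 \<in> Yi" using st1 st2 by (auto simp: stationary_def)
  have s2: "0 \<le> s2" "s2 * lf1 \<le> \<rho>g" using s2 by (auto simp: admissible_def)
  have R: "0 \<le> R"
    using lg1_nonneg lf0_nonneg rho_pos by (simp add: R_def)
  have d: "0 \<le> d" using y1 by (simp add: d_def lnorm_nonneg)
  define w where "w = (gy x2 y1 - gy x1 y1) + s2 *\<^sub>R (fy x2 y1 - fy x1 y1) + (s2 - s1) *\<^sub>R fy x1 y1"
  have "norm (gy x2 y1 - gy x1 y1) \<le> lg1 * norm (x2 - x1)"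
    using gy_lipschitz[of "(x2, y1)" "(x1, y1)"]
    by (simp add: norm_Pair)
  moreover have "norm (s2 *\<^sub>R (fy x2 y1 - fy x1 y1)) \<le> \<rho>g * norm (x2 - x1)"
  proof -
    have "norm (fy x2 y1 - fy x1 y1) \<le> lf1 * norm (x2 - x1)"
      using fy_lipschitz[of "(x2, y1)" "(x1, y1)"]
      by (simp add: norm_Pair)
    then have "norm (s2 *\<^sub>R (fy x2 y1 - fy x1 y1)) \<le> s2 * (lf1 * norm (x2 - x1))"
      using s2 by (simp add: mult_left_mono)
    also have "\<dots> \<le> \<rho>g * norm (x2 - x1)"
      using s2 by (simp add: mult_right_mono flip: mult.assoc)
    finally show ?thesis .
  qed
  moreover have "norm ((s2 - s1) *\<^sub>R fy x1 y1) \<le> lf0 * \<bar>s2 - s1\<bar>"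
    using mult_left_mono[OF norm_fy[of x1 y1], of "\<bar>s2 - s1\<bar>"] by (simp add: mult.commute)
  moreover have "norm w \<le> norm (gy x2 y1 - gy x1 y1) + norm (s2 *\<^sub>R (fy x2 y1 - fy x1 y1))
      + norm ((s2 - s1) *\<^sub>R fy x1 y1)"
    unfolding w_def by (intro norm_triangle_le add_mono order_refl)
  ultimately have w: "norm w \<le> R"
    unfolding R_def distrib_right by linarith
  have mono: "0 \<le> (gy x2 y2 - gy x2 y1 + s2 *\<^sub>R (fy x2 y2 - fy x2 y1)) \<bullet> u"
  proof -
    have "norm (fy x2 y2 - fy x2 y1) \<le> lf1 * norm u"
      using fy_lipschitz[of "(x2, y2)" "(x2, y1)"]
      by (simp add: norm_Pair u_def)
    then have "norm (fy x2 y2 - fy x2 y1) * norm u \<le> lf1 * norm u * norm u" by (intro mult_right_mono) auto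
    then have "\<bar>(fy x2 y2 - fy x2 y1) \<bullet> u\<bar> \<le> lf1 * (norm u)\<^sup>2"
      using Cauchy_Schwarz_ineq2[of "fy x2 y2 - fy x2 y1" u] by (simp add: power2_eq_square mult.assoc)
    then have "s2 * \<bar>(fy x2 y2 - fy x2 y1) \<bullet> u\<bar> \<le> s2 * (lf1 * (norm u)\<^sup>2)"
      using s2 by (intro mult_left_mono)
    also have "\<dots> \<le> \<rho>g * (norm u)\<^sup>2"
      using s2 by (simp add: mult_right_mono flip: mult.assoc)
    also have "\<dots> \<le> (gy x2 y2 - gy x2 y1) \<bullet> u" unfolding u_def by (rule gy_monotone)
    finally have "\<bar>s2 * ((fy x2 y2 - fy x2 y1) \<bullet> u)\<bar> \<le> (gy x2 y2 - gy x2 y1) \<bullet> u"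
      using s2 by (simp add: abs_mult)
    then show ?thesis by (simp add: inner_add_left abs_le_iff)
  qed
  have "\<mu> *\<^sub>R (barrier_grad A b y2 - barrier_grad A b y1)
      = - (gy x2 y2 - gy x2 y1 + s2 *\<^sub>R (fy x2 y2 - fy x2 y1)) - w"
  proof -
    have b2: "\<mu> *\<^sub>R barrier_grad A b y2 = - (gy x2 y2 + s2 *\<^sub>R fy x2 y2)"
      and b1: "\<mu> *\<^sub>R barrier_grad A b y1 = - (gy x1 y1 + s1 *\<^sub>R fy x1 y1)"
      using st1 st2 by (simp_all only: stationary_barrier_grad)
    show ?thesis unfolding scaleR_diff_right w_def b1 b2 by (simp add: algebra_simps)
  qed
  then have "\<mu> * ((barrier_grad A b y2 - barrier_grad A b y1) \<bullet> u)
      = - ((gy x2 y2 - gy x2 y1 + s2 *\<^sub>R (fy x2 y2 - fy x2 y1)) \<bullet> u) - w \<bullet> u"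
    unfolding inner_scaleR_left[symmetric, of \<mu>]
    by (simp only: inner_diff_left[of _ w] inner_minus_left)
  then have "\<mu> * ((barrier_grad A b y2 - barrier_grad A b y1) \<bullet> u) \<le> norm w * norm u"
    using mono Cauchy_Schwarz_ineq2[of w u] by (simp add: abs_le_iff)
  also have "\<dots> \<le> R * norm u" using w by (intro mult_right_mono) auto
  finally have "\<mu> * ((barrier_grad A b y2 - barrier_grad A b y1) \<bullet> u) \<le> R * norm u" .
  moreover have "\<mu> * (d\<^sup>2 / (1 + d)) \<le> \<mu> * ((barrier_grad A b y2 - barrier_grad A b y1) \<bullet> u)"
    using barrier_grad_monotone[OF y1 y2] mu_pos unfolding d_def u_def by (intro mult_left_mono) auto
  ultimately have key: "\<mu> * (d\<^sup>2 / (1 + d)) \<le> R * norm u" by linarith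
  \<comment> \<open>for \<open>d \<le> 1\<close> use \<open>\<parallel>u\<parallel> \<le> D d\<close>, for \<open>d > 1\<close> use \<open>\<parallel>u\<parallel> \<le> D\<close>\<close>
  have "\<mu> * d \<le> 2 * D * R"
  proof (cases "d \<le> 1")
    case True
    have "d\<^sup>2 / 2 \<le> d\<^sup>2 / (1 + d)" using True d by (intro divide_left_mono) auto
    then have "\<mu> * (d\<^sup>2 / 2) \<le> \<mu> * (d\<^sup>2 / (1 + d))" using mu_pos by (intro mult_left_mono) auto
    also have "\<dots> \<le> R * norm u" by (rule key)
    also have "\<dots> \<le> R * (D * d)" unfolding d_def by (intro mult_left_mono norm_le_lnorm y1 R)
    finally have "\<mu> * (d\<^sup>2 / 2) \<le> R * (D * d)" .
    then have "(\<mu> * d) * d \<le> (2 * D * R) * d" by (simp add: power2_eq_square mult_ac)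
    then show ?thesis
      using d R D_nonneg by (cases "d = 0") (auto simp: mult_le_cancel_right)
  next
    case False
    have "d / 2 \<le> d\<^sup>2 / (1 + d)" using False by (simp add: field_simps power2_eq_square)
    then have "\<mu> * (d / 2) \<le> \<mu> * (d\<^sup>2 / (1 + d))" using mu_pos by (intro mult_left_mono) auto
    also have "\<dots> \<le> R * norm u" by (rule key)
    also have "\<dots> \<le> R * D" unfolding u_def by (intro mult_left_mono norm_diff_le_D y1 y2 R)
    finally have "\<mu> * (d / 2) \<le> R * D" .
    then show ?thesis by (simp add: mult_ac)
  qed
  then show ?thesis
    using mu_pos by (simp add: d_def u_def R_def pos_le_divide_eq mult_ac)
qed

definition x_rate :: real where "x_rate = 2 * D / \<mu> * (lg1 + \<rho>g)"
definition s_rate :: real where "s_rate = 2 * D / \<mu> * lf0"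

lemma x_rate_nonneg: "0 \<le> x_rate" and s_rate_nonneg: "0 \<le> s_rate"
  using D_nonneg mu_pos lg1_nonneg rho_pos lf0_nonneg by (auto simp: x_rate_def s_rate_def)

lemma stationary_lipschitz_x:
  assumes "stationary s x1 y1" "stationary s x2 y2" "admissible s"
  shows "lnorm A b y1 (y2 - y1) \<le> x_rate * norm (x2 - x1)"
  using stationary_stability[OF assms] by (simp add: x_rate_def mult_ac)

lemma stationary_lipschitz_s:
  assumes "stationary s1 x y1" "stationary s2 x y2" "admissible s2"
  shows "lnorm A b y1 (y2 - y1) \<le> s_rate * \<bar>s2 - s1\<bar>"
  using stationary_stability[OF assms] by (simp add: s_rate_def mult_ac)

text \<open>
  Inserting the minimizer of one parameter as a competitor at the other bounds the change of the minimal value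
  from both sides by changes of the objective at a fixed \<open>y\<close>. As the minimizers are Lipschitz in \<open>x\<close>,
  the two bounds differ by a quadratic term only.
\<close>

lemma envelope_derivative:
  assumes sol: "\<And>x. minimizer s x (sol x)" and s: "admissible s"
  shows "((\<lambda>x. objective s x (sol x)) has_derivative
    (\<lambda>u. (gx x (sol x) + s *\<^sub>R fx x (sol x)) \<bullet> u)) (at x)"
proof (rule quadratic_remainder_has_derivative)
  fix x'
  define L where "L = lg1 + s * lf1"
  define r where "r = norm (x' - x)"
  have s0: "0 \<le> s" using s by (simp add: admissible_def)
  have L: "0 \<le> L" using lg1_nonneg lf1_nonneg s0 by (simp add: L_def)
  have taylor: "\<bar>objective s x' y - objective s x y - (gx x y + s *\<^sub>R fx x y) \<bullet> (x' - x)\<bar> \<le> L * r\<^sup>2" for y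
  proof -
    have g: "\<bar>g (x', y) - g (x, y) - gx x y \<bullet> (x' - x)\<bar> \<le> lg1 * r\<^sup>2"
      using gradient_taylor_bound[OF diff_g lip_g, of "(x', y)" "(x, y)"]
      by (simp add: inner_prod_def norm_Pair r_def)
    have f: "\<bar>f (x', y) - f (x, y) - fx x y \<bullet> (x' - x)\<bar> \<le> lf1 * r\<^sup>2"
      using gradient_taylor_bound[OF diff_f lip_f, of "(x', y)" "(x, y)"]
      by (simp add: inner_prod_def norm_Pair r_def)
    have "\<bar>s * (f (x', y) - f (x, y) - fx x y \<bullet> (x' - x))\<bar> \<le> s * (lf1 * r\<^sup>2)"
      using mult_left_mono[OF f s0] s0 by (simp add: abs_mult)
    then show ?thesis using g
      by (simp add: objective_def L_def inner_add_left algebra_simps abs_le_iff)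
  qed
  have sx: "sol x \<in> Yi" "sol x' \<in> Yi" using sol by (auto simp: minimizer_def)
  have "norm (sol x' - sol x) \<le> D * lnorm A b (sol x) (sol x' - sol x)"
    by (rule norm_le_lnorm[OF sx(1)])
  also have "\<dots> \<le> D * (x_rate * r)"
    unfolding r_def using D_nonneg
    by (intro mult_left_mono stationary_lipschitz_x[OF _ _ s] minimizer_imp_stationary sol) auto
  finally have dsol: "norm (sol x' - sol x) \<le> D * (x_rate * r)" .
  have shift: "\<bar>(gx x (sol x') + s *\<^sub>R fx x (sol x')) \<bullet> (x' - x) - (gx x (sol x) + s *\<^sub>R fx x (sol x)) \<bullet> (x' - x)\<bar>
      \<le> L * (D * x_rate) * r\<^sup>2"
  proof -
    define e where "e = norm (sol x' - sol x)"
    have "norm (gx x (sol x') - gx x (sol x)) \<le> lg1 * e"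
      using gx_lipschitz[of "(x, sol x')" "(x, sol x)"]
      by (simp add: norm_Pair e_def)
    moreover have "norm (fx x (sol x') - fx x (sol x)) \<le> lf1 * e"
      using fx_lipschitz[of "(x, sol x')" "(x, sol x)"]
      by (simp add: norm_Pair e_def)
    then have "norm (s *\<^sub>R (fx x (sol x') - fx x (sol x))) \<le> s * (lf1 * e)"
      using s0 by (simp add: mult_left_mono)
    ultimately have "norm ((gx x (sol x') - gx x (sol x)) + s *\<^sub>R (fx x (sol x') - fx x (sol x))) \<le> L * e"
      by (intro norm_triangle_le) (simp add: L_def algebra_simps)
    also have "\<dots> \<le> L * (D * (x_rate * r))"
      using dsol L unfolding e_def by (intro mult_left_mono)
    finally have "norm ((gx x (sol x') - gx x (sol x)) + s *\<^sub>R (fx x (sol x') - fx x (sol x))) * r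
        \<le> L * (D * (x_rate * r)) * r"
      by (intro mult_right_mono) (auto simp: r_def)
    moreover have "(gx x (sol x') + s *\<^sub>R fx x (sol x')) \<bullet> (x' - x) - (gx x (sol x) + s *\<^sub>R fx x (sol x)) \<bullet> (x' - x)
      = ((gx x (sol x') - gx x (sol x)) + s *\<^sub>R (fx x (sol x') - fx x (sol x))) \<bullet> (x' - x)"
      by (simp add: inner_add_left inner_diff_left algebra_simps)
    ultimately show ?thesis
      using Cauchy_Schwarz_ineq2[of "(gx x (sol x') - gx x (sol x)) + s *\<^sub>R (fx x (sol x') - fx x (sol x))" "x' - x"]
      by (simp add: r_def power2_eq_square mult_ac)
  qed
  have "objective s x' (sol x') \<le> objective s x' (sol x)" "objective s x (sol x) \<le> objective s x (sol x')"
    using sol[of x] sol[of x'] sx by (auto simp: minimizer_def)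
  moreover have "0 \<le> L * (D * x_rate) * r\<^sup>2" using L D_nonneg x_rate_nonneg by simp
  ultimately show "\<bar>objective s x' (sol x') - objective s x (sol x) - (gx x (sol x) + s *\<^sub>R fx x (sol x)) \<bullet> (x' - x)\<bar>
      \<le> (L + L * (D * x_rate)) * (norm (x' - x))\<^sup>2"
    using taylor[of "sol x"] taylor[of "sol x'"] shift unfolding r_def[symmetric] distrib_right by linarith
qed

end

context bilevel_barrier
begin

section \<open>The hypergradient\<close>

lemma linear_hess_g: "linear (hess g z)"
  by (rule linear_hess[OF C2_g])

lemma lg2_nonneg: "0 \<le> lg2"
proof -
  define z :: "(real^'k) \<times> (real^'n)" where "z = (axis undefined 1, 0)"
  have "0 \<le> onorm (\<lambda>u. hess g z u - hess g 0 u)"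
    by (intro onorm_pos_le bounded_linear_sub has_derivative_bounded_linear[OF has_derivative_hess[OF C2_g]])
  also have "\<dots> \<le> lg2 * norm (z - 0)" by (rule lip_hess_g)
  finally show ?thesis by (simp add: z_def zero_le_mult_iff)
qed

lemma norm_hess_g: "norm (hess g z u) \<le> lg1 * norm u"
  by (rule hess_bound[OF C2_g lip_hess_g lip_g])

lemma hess_g_symmetric: "hess g z u \<bullet> v = hess g z v \<bullet> u"
  by (rule hess_symmetric[OF C2_g lip_hess_g])

lemma hess_g_taylor: "norm (grad g z' - grad g z - hess g z (z' - z)) \<le> lg2 * (norm (z' - z))\<^sup>2"
  by (rule hessian_taylor_bound[OF C2_g lip_hess_g])

text \<open>
  The gradient of \<open>g(x,\<cdot>)\<close> is monotone, and this passes to its linearisation.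
\<close>

lemma hess_g_psd: "0 \<le> hess g (x, y) (0, u) \<bullet> (0, u)"
proof -
  have "- (hess g (x, y) (0, u) \<bullet> (0, u)) \<le> (lg2 * (norm u)\<^sup>2 * norm u) * t" if "0 < t" for t
  proof -
    define e where "e = grad g (x, y + t *\<^sub>R u) - grad g (x, y) - hess g (x, y) (0, t *\<^sub>R u)"
    have sc: "hess g (x, y) (0, t *\<^sub>R u) = t *\<^sub>R hess g (x, y) (0, u)"
      using linear_scale[OF linear_hess_g, of "(x, y)" t "(0, u)"] by simp
    have "0 \<le> (gy x (y + t *\<^sub>R u) - gy x y) \<bullet> (t *\<^sub>R u)"
      using gy_monotone[where ?y1.0 = y and ?y2.0 = "y + t *\<^sub>R u" and x = x] rho_pos
      by (smt (verit, best) add_diff_cancel_left' mult_nonneg_nonneg zero_le_power2)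
    then have "0 \<le> (grad g (x, y + t *\<^sub>R u) - grad g (x, y)) \<bullet> (0, u)"
      using \<open>0 < t\<close> by (simp add: inner_prod_def zero_le_mult_iff)
    then have "- t * (hess g (x, y) (0, u) \<bullet> (0, u)) \<le> e \<bullet> (0, u)"
      by (simp add: e_def sc inner_diff_left)
    also have "\<dots> \<le> norm e * norm ((0, u) :: (real^'k) \<times> (real^'n))" by (rule norm_cauchy_schwarz)
    also have "\<dots> \<le> (lg2 * (t * norm u)\<^sup>2) * norm u"
      using hess_g_taylor[of "(x, y + t *\<^sub>R u)" "(x, y)"] \<open>0 < t\<close>
      by (intro mult_mono) (auto simp: e_def intro: order_trans[OF norm_ge_zero])
    finally have "t * - (hess g (x, y) (0, u) \<bullet> (0, u)) \<le> t * ((lg2 * (norm u)\<^sup>2 * norm u) * t)"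
      by (simp add: power2_eq_square mult_ac)
    then show ?thesis using \<open>0 < t\<close> by (simp only: mult_le_cancel_left_pos)
  qed
  from zero_if_le_all_multiples[OF this] show ?thesis by simp
qed

text \<open>
  The weak form of \<open>\<nabla>\<^sup>2\<^sub>y\<^sub>y\<psi>\<^sub>\<mu>(x,y) v = \<nabla>\<^sub>y f(x,y)\<close>; the \<open>yy\<close>-block of the Hessian of \<open>g\<close> is expressed by
  embedding \<open>v\<close> and \<open>u\<close> into the product space.
\<close>

definition adjoint_state :: "real^'k \<Rightarrow> real^'n \<Rightarrow> real^'n \<Rightarrow> bool" where
  "adjoint_state x y v \<longleftrightarrow>
    (\<forall>u. hess g (x, y) (0, v) \<bullet> (0, u) + \<mu> * (H y v \<bullet> u) = fy x y \<bullet> u)"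

lemma adjoint_state_exists:
  assumes "y \<in> Yi"
  shows "\<exists>v. adjoint_state x y v"
proof -
  define M where "M v = snd (hess g (x, y) (0, v)) + \<mu> *\<^sub>R H y v" for v
  have lin: "linear M"
  proof (rule linearI)
    fix v w :: "real^'n" and c :: real
    have "hess g (x, y) (0, v + w) = hess g (x, y) (0, v) + hess g (x, y) (0, w)"
      using linear_add[OF linear_hess_g, of "(x, y)" "(0, v)" "(0, w)"] by simp
    then show "M (v + w) = M v + M w"
      by (simp add: M_def linear_add[OF linear_H[OF assms]] scaleR_add_right)
    have "hess g (x, y) (0, c *\<^sub>R v) = c *\<^sub>R hess g (x, y) (0, v)"
      using linear_scale[OF linear_hess_g, of "(x, y)" c "(0, v)"] by simp
    then show "M (c *\<^sub>R v) = c *\<^sub>R M v"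
      by (simp add: M_def linear_scale[OF linear_H[OF assms]] scaleR_add_right)
  qed
  have M: "M v \<bullet> u = hess g (x, y) (0, v) \<bullet> (0, u) + \<mu> * (H y v \<bullet> u)" for u v
    by (simp add: M_def inner_add_left inner_prod_def)
  have "inj M"
  proof (subst linear_injective_0[OF lin], intro allI impI)
    fix v assume "M v = 0"
    then have "hess g (x, y) (0, v) \<bullet> (0, v) + \<mu> * (lnorm A b y v)\<^sup>2 = 0"
      using M[of v v] by (simp add: lnorm_power2[OF assms])
    then have "\<mu> * (lnorm A b y v)\<^sup>2 \<le> 0" using hess_g_psd[of x y v] by linarith
    then have "lnorm A b y v = 0" using mu_pos by (simp add: mult_le_0_iff)
    then show "v = 0" using norm_le_lnorm[OF assms, of v] by simp
  qed
  then have "surj M" by (rule linear_inj_imp_surj[OF lin])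
  then obtain v where "M v = fy x y" by (metis surjD)
  then have "adjoint_state x y v" unfolding adjoint_state_def by (simp flip: M)
  then show ?thesis by blast
qed

text \<open>
  The barrier part of \<open>\<nabla>\<^sup>2\<^sub>y\<^sub>y\<psi>\<^sub>\<mu>\<close> alone makes the form coercive in the local norm, with constant \<open>\<mu>\<close>.
\<close>

lemma coercive_lnorm_bound:
  assumes y: "y \<in> Yi" and le: "hess g (x, y) (0, v) \<bullet> (0, v) + \<mu> * (H y v \<bullet> v) \<le> c * lnorm A b y v" and "0 \<le> c"
  shows "lnorm A b y v \<le> c / \<mu>"
proof -
  have "\<mu> * (lnorm A b y v)\<^sup>2 \<le> c * lnorm A b y v"
    using le hess_g_psd[of x y v] by (simp add: lnorm_power2[OF y])
  then have "(\<mu> * lnorm A b y v) * lnorm A b y v \<le> c * lnorm A b y v"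
    by (simp add: power2_eq_square mult_ac)
  then have "\<mu> * lnorm A b y v \<le> c"
    using lnorm_nonneg[OF y, of v] \<open>0 \<le> c\<close>
    by (cases "lnorm A b y v = 0") (auto simp: mult_le_cancel_right)
  then show ?thesis using mu_pos by (simp add: pos_le_divide_eq mult.commute)
qed

lemma adjoint_state_bound:
  assumes y: "y \<in> Yi" and v: "adjoint_state x y v"
  shows "lnorm A b y v \<le> lf0 * D / \<mu>"
proof (rule coercive_lnorm_bound[OF y])
  have "hess g (x, y) (0, v) \<bullet> (0, v) + \<mu> * (H y v \<bullet> v) = fy x y \<bullet> v"
    using v by (simp add: adjoint_state_def)
  also have "\<dots> \<le> norm (fy x y) * norm v" by (rule norm_cauchy_schwarz)
  also have "\<dots> \<le> lf0 * (D * lnorm A b y v)"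
    using lf0_nonneg by (intro mult_mono norm_fy norm_le_lnorm y) auto
  finally show "hess g (x, y) (0, v) \<bullet> (0, v) + \<mu> * (H y v \<bullet> v) \<le> lf0 * D * lnorm A b y v" by simp
  show "0 \<le> lf0 * D" using lf0_nonneg D_nonneg by simp
qed

text \<open>
  The difference of the two stationarity conditions, expanded to first order around \<open>(x1, y1)\<close> and tested
  with \<open>v\<close>. It is used with \<open>s = 0\<close> for the quadratic expansion of \<open>F\<^sub>\<mu>\<close> and with \<open>x2 = x1\<close> for the
  comparison with the penalty gradient.
\<close>

lemma stationarity_linearization:
  assumes st1: "stationary 0 x1 y1" and st2: "stationary s x2 y2"
    and small: "lnorm A b y1 (y2 - y1) \<le> 1 / 2"
  shows "\<bar>hess g (x1, y1) (x2 - x1, y2 - y1) \<bullet> (0, v) + \<mu> * (H y1 (y2 - y1) \<bullet> v) + s * (fy x2 y2 \<bullet> v)\<bar>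
    \<le> (lg2 * D * (norm (x2 - x1, y2 - y1))\<^sup>2 + 2 * \<mu> * (lnorm A b y1 (y2 - y1))\<^sup>2) * lnorm A b y1 v"
proof -
  have y: "y1 \<in> Yi" "y2 \<in> Yi" using st1 st2 by (auto simp: stationary_def)
  define n where "n = norm (x2 - x1, y2 - y1)"
  define d where "d = lnorm A b y1 (y2 - y1)"
  define e1 where "e1 = grad g (x2, y2) - grad g (x1, y1) - hess g (x1, y1) (x2 - x1, y2 - y1)"
  define e2 where "e2 = barrier_grad A b y2 - barrier_grad A b y1 - H y1 (y2 - y1)"
  have n1: "norm e1 \<le> lg2 * n\<^sup>2"
    using hess_g_taylor[of "(x2, y2)" "(x1, y1)"] by (simp add: e1_def n_def)
  have "\<bar>e1 \<bullet> (0, v)\<bar> \<le> norm e1 * norm v"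
    using Cauchy_Schwarz_ineq2[of e1 "(0, v)"] by simp
  also have "\<dots> \<le> lg2 * n\<^sup>2 * (D * lnorm A b y1 v)"
    using n1 by (intro mult_mono norm_le_lnorm y) (auto intro: order_trans[OF norm_ge_zero])
  finally have b1: "\<bar>e1 \<bullet> (0, v)\<bar> \<le> lg2 * n\<^sup>2 * (D * lnorm A b y1 v)" .
  have "\<bar>e2 \<bullet> v\<bar> \<le> 2 * d\<^sup>2 * lnorm A b y1 v"
    unfolding e2_def d_def by (rule barrier_grad_linearization[OF y small])
  then have b2: "\<bar>\<mu> * (e2 \<bullet> v)\<bar> \<le> \<mu> * (2 * d\<^sup>2 * lnorm A b y1 v)"
    using mu_pos by (simp add: abs_mult)
  have "\<mu> * (barrier_grad A b y2 \<bullet> v) = - (gy x2 y2 \<bullet> v) - s * (fy x2 y2 \<bullet> v)"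
    "\<mu> * (barrier_grad A b y1 \<bullet> v) = - (gy x1 y1 \<bullet> v)"
    using arg_cong[OF stationary_barrier_grad[OF st2], of "\<lambda>w. w \<bullet> v"]
      arg_cong[OF stationary_barrier_grad[OF st1], of "\<lambda>w. w \<bullet> v"]
    by (simp_all add: inner_add_left inner_diff_left)
  then have "hess g (x1, y1) (x2 - x1, y2 - y1) \<bullet> (0, v) + \<mu> * (H y1 (y2 - y1) \<bullet> v) + s * (fy x2 y2 \<bullet> v)
      = - (e1 \<bullet> (0, v)) - \<mu> * (e2 \<bullet> v)"
    unfolding e1_def e2_def by (simp add: inner_diff_left inner_prod_def right_diff_distrib)
  then show ?thesis
    using b1 b2 unfolding n_def[symmetric] d_def[symmetric]
    by (simp add: algebra_simps abs_le_iff)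
qed

text \<open>
  \<open>\<nabla>\<^sub>x f - (\<nabla>\<^sup>2\<^sub>x\<^sub>y g)\<^sup>T v\<close>, which is \<open>\<nabla>F\<^sub>\<mu>(x)\<close> when \<open>y = y\<^sub>\<mu>(x)\<close> and \<open>v\<close> is the adjoint state there.
\<close>

definition hypergrad :: "real^'k \<Rightarrow> real^'n \<Rightarrow> real^'n \<Rightarrow> real^'k" where
  "hypergrad x y v = fx x y - fst (hess g (x, y) (0, v))"

lemma hypergrad_inner: "hypergrad x y v \<bullet> u = grad f (x, y) \<bullet> (u, 0) - hess g (x, y) (0, v) \<bullet> (u, 0)"
  by (simp add: hypergrad_def inner_diff_left inner_prod_def)

lemma norm_hypergrad:
  assumes "y \<in> Yi" "adjoint_state x y v"
  shows "norm (hypergrad x y v) \<le> lf0 + lg1 * (D * (lf0 * D / \<mu>))"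
proof -
  have "norm (fst (hess g (x, y) (0, v))) \<le> norm (hess g (x, y) (0, v))"
    by (metis norm_fst_le prod.collapse)
  also have "\<dots> \<le> lg1 * norm v" using norm_hess_g[of "(x, y)" "(0, v)"] by simp
  also have "\<dots> \<le> lg1 * (D * (lf0 * D / \<mu>))"
    using order_trans[OF norm_le_lnorm[OF assms(1)] mult_left_mono[OF adjoint_state_bound[OF assms] D_nonneg]]
    by (intro mult_left_mono lg1_nonneg)
  finally show ?thesis
    unfolding hypergrad_def using norm_fx[of x y] norm_triangle_ineq4[of "fx x y" "fst (hess g (x, y) (0, v))"]
    by linarith
qed

text \<open>
  By the adjoint equation and the symmetry of the Hessians, \<open>\<langle>\<nabla>f, \<Delta>z\<rangle> - \<langle>hypergrad, \<Delta>x\<rangle>\<close> is the left-hand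
  side of the linearised stationarity condition tested with \<open>v\<close>, hence quadratic. The linearisation needs
  \<open>d \<le> 1/2\<close>; otherwise \<open>\<parallel>\<Delta>x\<parallel>\<close> is bounded below and the crude linear bound is already quadratic.
\<close>

lemma hyperobjective_quadratic_remainder:
  "\<exists>C. \<forall>x1 x2 y1 y2 v. stationary 0 x1 y1 \<longrightarrow> stationary 0 x2 y2 \<longrightarrow> adjoint_state x1 y1 v \<longrightarrow>
      \<bar>f (x2, y2) - f (x1, y1) - hypergrad x1 y1 v \<bullet> (x2 - x1)\<bar> \<le> C * (norm (x2 - x1))\<^sup>2"
proof -
  define N where "N = 1 + D * x_rate"
  define B where "B = lf0 + lg1 * (D * (lf0 * D / \<mu>))"
  define C1 where "C1 = lf1 * N\<^sup>2 + (lg2 * D * N\<^sup>2 + 2 * \<mu> * x_rate\<^sup>2) * (lf0 * D / \<mu>)"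
  define C2 where "C2 = (2 * lf0 * N + B) * (2 * x_rate)"
  have "\<bar>f (x2, y2) - f (x1, y1) - hypergrad x1 y1 v \<bullet> (x2 - x1)\<bar> \<le> (C1 + C2) * (norm (x2 - x1))\<^sup>2"
    if st1: "stationary 0 x1 y1" and st2: "stationary 0 x2 y2" and v: "adjoint_state x1 y1 v" for x1 x2 y1 y2 v
  proof -
    define r where "r = norm (x2 - x1)"
    define n where "n = norm (x2 - x1, y2 - y1)"
    define d where "d = lnorm A b y1 (y2 - y1)"
    have y1: "y1 \<in> Yi" using st1 by (simp add: stationary_def)
    have d0: "0 \<le> d" using y1 by (simp add: d_def lnorm_nonneg)
    have r0: "0 \<le> r" by (simp add: r_def)
    have adm: "admissible 0" using rho_pos by (simp add: admissible_def)
    have d: "d \<le> x_rate * r"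
      unfolding d_def r_def by (rule stationary_lipschitz_x[OF st1 st2 adm])
    have "norm (y2 - y1) \<le> D * (x_rate * r)"
      using norm_le_lnorm[OF y1, of "y2 - y1"] mult_left_mono[OF d D_nonneg] by (simp add: d_def)
    then have n: "n \<le> N * r"
      using norm_Pair_le[of "x2 - x1" "y2 - y1"] by (simp add: n_def N_def r_def algebra_simps)
    have N0: "0 \<le> N" using D_nonneg x_rate_nonneg by (simp add: N_def)
    have lg2: "0 \<le> lg2 * D * k\<^sup>2" for k using lg2_nonneg D_nonneg by simp
    have B0: "0 \<le> B" using lf0_nonneg lg1_nonneg D_nonneg mu_pos by (simp add: B_def)
    have C1: "0 \<le> C1"
      using lf1_nonneg lf0_nonneg lg2[of N] D_nonneg mu_pos by (simp add: C1_def)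
    have C2: "0 \<le> C2" using lf0_nonneg N0 B0 x_rate_nonneg by (simp add: C2_def)
    have "\<bar>f (x2, y2) - f (x1, y1) - hypergrad x1 y1 v \<bullet> (x2 - x1)\<bar> \<le> (if d \<le> 1 / 2 then C1 else C2) * r\<^sup>2"
    proof (cases "d \<le> 1 / 2")
      case True
      define p where "p = (x2 - x1, y2 - y1)"
      have H_sym: "H y1 v \<bullet> (y2 - y1) = H y1 (y2 - y1) \<bullet> v"
        unfolding H_inner[OF y1] by (rule inner_commute)
      have "grad f (x1, y1) \<bullet> p - hypergrad x1 y1 v \<bullet> (x2 - x1)
          = hess g (x1, y1) (0, v) \<bullet> p + \<mu> * (H y1 v \<bullet> (y2 - y1))"
        using v[unfolded adjoint_state_def, rule_format, of "y2 - y1"]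
        by (simp add: hypergrad_inner p_def inner_prod_def)
      also have "\<dots> = hess g (x1, y1) p \<bullet> (0, v) + \<mu> * (H y1 (y2 - y1) \<bullet> v)"
        by (simp only: hess_g_symmetric[of "(x1, y1)" "(0, v)" p] H_sym)
      also have "\<bar>\<dots>\<bar> \<le> (lg2 * D * n\<^sup>2 + 2 * \<mu> * d\<^sup>2) * lnorm A b y1 v"
        using stationarity_linearization[OF st1 st2] True by (simp add: n_def d_def p_def)
      also have "\<dots> \<le> (lg2 * D * (N * r)\<^sup>2 + 2 * \<mu> * (x_rate * r)\<^sup>2) * (lf0 * D / \<mu>)"
      proof (rule mult_mono)
        have "lg2 * D * n\<^sup>2 \<le> lg2 * D * (N * r)\<^sup>2"
          using lg2[of 1] n by (intro mult_left_mono power_mono) (auto simp: n_def)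
        moreover have "2 * \<mu> * d\<^sup>2 \<le> 2 * \<mu> * (x_rate * r)\<^sup>2"
          using mu_pos d d0 by (intro mult_left_mono power_mono) auto
        ultimately show "lg2 * D * n\<^sup>2 + 2 * \<mu> * d\<^sup>2 \<le> lg2 * D * (N * r)\<^sup>2 + 2 * \<mu> * (x_rate * r)\<^sup>2"
          by linarith
        show "lnorm A b y1 v \<le> lf0 * D / \<mu>" by (rule adjoint_state_bound[OF y1 v])
        show "0 \<le> lg2 * D * (N * r)\<^sup>2 + 2 * \<mu> * (x_rate * r)\<^sup>2" using lg2[of "N * r"] mu_pos by simp
      qed (use lnorm_nonneg[OF y1] in auto)
      also have "\<dots> = (lg2 * D * N\<^sup>2 + 2 * \<mu> * x_rate\<^sup>2) * (lf0 * D / \<mu>) * r\<^sup>2"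
        by (simp add: power_mult_distrib distrib_left mult_ac)
      finally have b2: "\<bar>grad f (x1, y1) \<bullet> p - hypergrad x1 y1 v \<bullet> (x2 - x1)\<bar> \<le> \<dots>" .
      have "\<bar>f (x2, y2) - f (x1, y1) - grad f (x1, y1) \<bullet> p\<bar> \<le> lf1 * n\<^sup>2"
        using gradient_taylor_bound[OF diff_f lip_f, of "(x2, y2)" "(x1, y1)"] by (simp add: n_def p_def)
      also have "\<dots> \<le> lf1 * (N * r)\<^sup>2"
        using n lf1_nonneg by (intro mult_left_mono power_mono) (auto simp: n_def)
      also have "\<dots> = lf1 * N\<^sup>2 * r\<^sup>2" by (simp add: power_mult_distrib)
      finally show ?thesis using b2 True by (simp add: C1_def distrib_right)
    next
      case False
      have "1 \<le> 2 * x_rate * r" using False d by simp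
      then have big: "r \<le> (2 * x_rate) * r\<^sup>2"
        using mult_right_mono[of 1 "2 * x_rate * r" r] r0 by (simp add: power2_eq_square mult_ac)
      have "\<bar>f (x2, y2) - f (x1, y1)\<bar> \<le> 2 * lf0 * (N * r)"
        using f_lipschitz[of "(x2, y2)" "(x1, y1)"] mult_left_mono[OF n, of "2 * lf0"] lf0_nonneg
        by (simp add: n_def)
      moreover have "\<bar>hypergrad x1 y1 v \<bullet> (x2 - x1)\<bar> \<le> B * r"
        using Cauchy_Schwarz_ineq2[of "hypergrad x1 y1 v" "x2 - x1"]
          mult_right_mono[OF norm_hypergrad[OF y1 v] r0] by (simp add: B_def r_def)
      ultimately have "\<bar>f (x2, y2) - f (x1, y1) - hypergrad x1 y1 v \<bullet> (x2 - x1)\<bar> \<le> (2 * lf0 * N + B) * r"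
        by (simp add: algebra_simps abs_le_iff)
      also have "\<dots> \<le> (2 * lf0 * N + B) * ((2 * x_rate) * r\<^sup>2)"
        using big lf0_nonneg N0 B0 by (intro mult_left_mono) auto
      finally show ?thesis using False by (simp add: C2_def mult_ac)
    qed
    also have "\<dots> \<le> (C1 + C2) * r\<^sup>2"
      using C1 C2 by (intro mult_right_mono) auto
    finally show ?thesis by (simp add: r_def)
  qed
  then show ?thesis by blast
qed

text \<open>
  With \<open>\<delta> = y' - y = O(1/\<lambda>)\<close>, the linearised stationarity condition says that \<open>- \<lambda> \<delta>\<close> solves the adjoint
  equation up to \<open>O(1/\<lambda>)\<close>, so \<open>e = v + \<lambda> \<delta>\<close> is \<open>O(1/\<lambda>)\<close>. The gradient error equals the image of \<open>e\<close>
  under the mixed Hessian of \<open>g\<close>, up to terms that are \<open>O(1/\<lambda>)\<close> by Taylor expansion.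
\<close>

lemma penalty_gradient_error:
  "\<exists>c. \<forall>x y y' v lam. stationary 0 x y \<longrightarrow> stationary (1 / lam) x y' \<longrightarrow> admissible (1 / lam) \<longrightarrow>
      0 < lam \<longrightarrow> 2 * s_rate \<le> lam \<longrightarrow> adjoint_state x y v \<longrightarrow>
      norm (hypergrad x y v - lam *\<^sub>R ((gx x y' + (1 / lam) *\<^sub>R fx x y') - gx x y)) \<le> c / lam"
proof -
  define K where "K = s_rate"
  define E where "E = (lf1 * (D * K) * D + (lg2 * D * (D * K)\<^sup>2 + 2 * \<mu> * K\<^sup>2)) / \<mu>"
  have "norm (hypergrad x y v - lam *\<^sub>R ((gx x y' + (1 / lam) *\<^sub>R fx x y') - gx x y))
      \<le> (lf1 * (D * K) + lg1 * (D * E) + lg2 * (D * K)\<^sup>2) / lam"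
    if st: "stationary 0 x y" and st': "stationary (1 / lam) x y'" and adm: "admissible (1 / lam)"
      and lam: "0 < lam" and small: "2 * s_rate \<le> lam" and v: "adjoint_state x y v" for x y y' v lam
  proof -
    have y: "y \<in> Yi" using st by (simp add: stationary_def)
    define \<delta> where "\<delta> = y' - y"
    define d where "d = lnorm A b y \<delta>"
    have d0: "0 \<le> d" using y by (simp add: d_def lnorm_nonneg)
    have K0: "0 \<le> K" using s_rate_nonneg by (simp add: K_def)
    have d: "d \<le> K / lam"
      using stationary_lipschitz_s[OF st st' adm] lam by (simp add: d_def \<delta>_def K_def)
    have "K / lam \<le> 1 / 2"
      using small lam by (simp add: K_def pos_divide_le_eq)
    with d have d12: "d \<le> 1 / 2" by linarith
    have nd: "norm \<delta> \<le> D * K / lam"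
      using norm_le_lnorm[OF y, of \<delta>] mult_left_mono[OF d D_nonneg] by (simp add: d_def)
    define e where "e = v + lam *\<^sub>R \<delta>"
    define R where "R = lg2 * D * (norm \<delta>)\<^sup>2 + 2 * \<mu> * d\<^sup>2"
    have hess_e: "hess g (x, y) (0, e) = hess g (x, y) (0, v) + lam *\<^sub>R hess g (x, y) (0, \<delta>)"
    proof -
      have "(0, e) = (0, v) + lam *\<^sub>R (0 :: real^'k, \<delta>)" by (simp add: e_def)
      then show ?thesis by (simp only: linear_add[OF linear_hess_g] linear_scale[OF linear_hess_g])
    qed
    have muE: "\<mu> * E = lf1 * (D * K) * D + (lg2 * D * (D * K)\<^sup>2 + 2 * \<mu> * K\<^sup>2)"
      using mu_pos by (simp add: E_def)
    have ne: "lnorm A b y e \<le> E / lam"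
    proof -
      have H_e: "H y e = H y v + lam *\<^sub>R H y \<delta>"
        by (simp add: e_def linear_add[OF linear_H[OF y]] linear_scale[OF linear_H[OF y]])
      have res: "\<bar>hess g (x, y) (0, \<delta>) \<bullet> (0, e) + \<mu> * (H y \<delta> \<bullet> e) + (1 / lam) * (fy x y' \<bullet> e)\<bar>
          \<le> R * lnorm A b y e" (is "\<bar>?res\<bar> \<le> _")
        using stationarity_linearization[OF st st'] d12 by (simp add: \<delta>_def d_def R_def)
      have "hess g (x, y) (0, e) \<bullet> (0, e) + \<mu> * (H y e \<bullet> e)
          = (hess g (x, y) (0, v) \<bullet> (0, e) + \<mu> * (H y v \<bullet> e)) + lam * (hess g (x, y) (0, \<delta>) \<bullet> (0, e) + \<mu> * (H y \<delta> \<bullet> e))"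
        by (simp add: hess_e H_e inner_add_left algebra_simps)
      also have "\<dots> = (fy x y - fy x y') \<bullet> e + lam * ?res"
        using v lam by (simp add: adjoint_state_def inner_diff_left algebra_simps)
      also have "\<dots> \<le> lf1 * (D * K / lam) * (D * lnorm A b y e) + lam * (R * lnorm A b y e)"
      proof (intro add_mono mult_left_mono)
        have "norm (fy x y - fy x y') \<le> lf1 * norm \<delta>"
          using fy_lipschitz[of "(x, y)" "(x, y')"] by (simp add: \<delta>_def norm_minus_commute)
        also have "\<dots> \<le> lf1 * (D * K / lam)" by (intro mult_left_mono nd lf1_nonneg)
        finally have "norm (fy x y - fy x y') * norm e \<le> lf1 * (D * K / lam) * (D * lnorm A b y e)"
          using lf1_nonneg D_nonneg K0 lam by (intro mult_mono norm_le_lnorm y) auto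
        then show "(fy x y - fy x y') \<bullet> e \<le> lf1 * (D * K / lam) * (D * lnorm A b y e)"
          using norm_cauchy_schwarz[of "fy x y - fy x y'" e] by linarith
        show "?res \<le> R * lnorm A b y e" using res by linarith
      qed (use lam in auto)
      also have "\<dots> = (lf1 * (D * K) * D / lam + lam * R) * lnorm A b y e" by (simp add: field_simps)
      also have "\<dots> \<le> (\<mu> * E / lam) * lnorm A b y e"
      proof (rule mult_right_mono)
        have "R \<le> lg2 * D * (D * K / lam)\<^sup>2 + 2 * \<mu> * (K / lam)\<^sup>2"
          unfolding R_def using lg2_nonneg D_nonneg mu_pos d d0 nd by (intro add_mono mult_left_mono power_mono) auto
        then have "lam * R \<le> lam * (lg2 * D * (D * K / lam)\<^sup>2 + 2 * \<mu> * (K / lam)\<^sup>2)"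
          using lam by (intro mult_left_mono) auto
        also have "\<dots> = (lg2 * D * (D * K)\<^sup>2 + 2 * \<mu> * K\<^sup>2) / lam"
          using lam by (simp add: power_divide power2_eq_square field_simps)
        finally show "lf1 * (D * K) * D / lam + lam * R \<le> \<mu> * E / lam"
          unfolding muE by (simp add: add_divide_distrib)
      qed (rule lnorm_nonneg[OF y])
      finally have "lnorm A b y e \<le> (\<mu> * E / lam) / \<mu>"
      proof (rule coercive_lnorm_bound[OF y])
        show "0 \<le> \<mu> * E / lam"
          using mu_pos lam lg2_nonneg lf1_nonneg D_nonneg K0 by (simp add: E_def)
      qed
      then show ?thesis using mu_pos by simp
    qed
    have triangle: "norm (p - q - r) \<le> i + j + k" if "norm p \<le> i" "norm q \<le> j" "norm r \<le> k"
      for p q r :: "real^'k" and i j k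
      using that norm_triangle_ineq4[of p q] norm_triangle_ineq4[of "p - q" r] by linarith
    have split: "hypergrad x y v - lam *\<^sub>R ((gx x y' + (1 / lam) *\<^sub>R fx x y') - gx x y)
        = (fx x y - fx x y') - fst (hess g (x, y) (0, e))
          - lam *\<^sub>R fst (grad g (x, y') - grad g (x, y) - hess g (x, y) (0, \<delta>))"
      unfolding hypergrad_def hess_e using lam by (simp add: algebra_simps)
    have "norm (fx x y - fx x y') \<le> lf1 * (D * K / lam)"
      using fx_lipschitz[of "(x, y)" "(x, y')"] mult_left_mono[OF nd lf1_nonneg]
      by (simp add: \<delta>_def norm_minus_commute)
    moreover have "norm (fst (hess g (x, y) (0, e))) \<le> lg1 * (D * (E / lam))"
    proof -
      have "norm (fst (hess g (x, y) (0, e))) \<le> norm (hess g (x, y) (0, e))"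
        by (metis norm_fst_le prod.collapse)
      also have "\<dots> \<le> lg1 * norm e" using norm_hess_g[of "(x, y)" "(0, e)"] by simp
      also have "\<dots> \<le> lg1 * (D * (E / lam))"
        using order_trans[OF norm_le_lnorm[OF y] mult_left_mono[OF ne D_nonneg]]
        by (intro mult_left_mono lg1_nonneg)
      finally show ?thesis .
    qed
    moreover have "norm (lam *\<^sub>R fst (grad g (x, y') - grad g (x, y) - hess g (x, y) (0, \<delta>))) \<le> lg2 * (D * K)\<^sup>2 / lam"
    proof -
      have "norm (fst (grad g (x, y') - grad g (x, y) - hess g (x, y) (0, \<delta>)))
          \<le> norm (grad g (x, y') - grad g (x, y) - hess g (x, y) (0, \<delta>))"
        by (metis norm_fst_le prod.collapse)
      also have "\<dots> \<le> lg2 * (norm \<delta>)\<^sup>2"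
        using hess_g_taylor[of "(x, y')" "(x, y)"] by (simp add: \<delta>_def)
      also have "\<dots> \<le> lg2 * (D * K / lam)\<^sup>2" by (intro mult_left_mono power_mono nd lg2_nonneg) auto
      finally have "lam * norm (fst (grad g (x, y') - grad g (x, y) - hess g (x, y) (0, \<delta>))) \<le> lam * (lg2 * (D * K / lam)\<^sup>2)"
        using lam by (intro mult_left_mono) auto
      also have "\<dots> = lg2 * (D * K)\<^sup>2 / lam"
        using lam by (simp add: power_divide power2_eq_square)
      finally show ?thesis using lam by simp
    qed
    ultimately have "norm (hypergrad x y v - lam *\<^sub>R ((gx x y' + (1 / lam) *\<^sub>R fx x y') - gx x y))
        \<le> lf1 * (D * K / lam) + lg1 * (D * (E / lam)) + lg2 * (D * K)\<^sup>2 / lam"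
      unfolding split by (rule triangle)
    also have "\<dots> = (lf1 * (D * K) + lg1 * (D * E) + lg2 * (D * K)\<^sup>2) / lam"
      by (simp add: add_divide_distrib)
    finally show ?thesis .
  qed
  then show ?thesis by blast
qed

end

context bilevel_barrier
begin

section \<open>The penalised problems\<close>

lemma psi_eq_objective: "psi A b g \<mu> (x, y) = objective 0 x y"
  by (simp add: psi_def objective_def)

lemma minimizer_y_mu: "minimizer 0 x (y_mu A b g \<mu> x)"
proof -
  have "\<exists>y\<in>Yi. \<forall>z\<in>Yi. psi A b g \<mu> (x, y) \<le> psi A b g \<mu> (x, z)"
    using minimizer_exists[of 0 x] by (auto simp: minimizer_def psi_eq_objective)
  from arg_min_on_minimizes[OF this] show ?thesis
    by (simp add: minimizer_def y_mu_def psi_eq_objective)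
qed

lemma psi_star_eq: "psi_star A b g \<mu> x = objective 0 x (y_mu A b g \<mu> x)"
  unfolding psi_star_def psi_eq_objective using minimizer_y_mu[of x]
  by (intro INF_eq_value_at_minimizer) (auto simp: minimizer_def)

lemma penalty_eq_objective:
  assumes "0 < lam"
  shows "penalty A b f g \<mu> lam x y = lam * (objective (1 / lam) x y - objective 0 x (y_mu A b g \<mu> x))"
  using assms by (simp add: penalty_def psi_eq_objective psi_star_eq objective_def field_simps)

lemma minimizer_y_lam:
  assumes "0 < lam"
  shows "minimizer (1 / lam) x (y_lam A b f g \<mu> lam x)"
proof -
  have mono: "penalty A b f g \<mu> lam x y \<le> penalty A b f g \<mu> lam x z
      \<longleftrightarrow> objective (1 / lam) x y \<le> objective (1 / lam) x z" for y z
    using assms by (simp add: penalty_eq_objective)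
  have "\<exists>y\<in>Yi. \<forall>z\<in>Yi. penalty A b f g \<mu> lam x y \<le> penalty A b f g \<mu> lam x z"
    unfolding mono using minimizer_exists[of "1 / lam" x] by (auto simp: minimizer_def)
  from arg_min_on_minimizes[OF this] show ?thesis
    unfolding mono by (simp add: minimizer_def y_lam_def)
qed

lemma C_star_eq:
  assumes "0 < lam"
  shows "C_star A b f g \<mu> lam x =
    lam * (objective (1 / lam) x (y_lam A b f g \<mu> lam x) - objective 0 x (y_mu A b g \<mu> x))"
proof -
  have "C_star A b f g \<mu> lam x = penalty A b f g \<mu> lam x (y_lam A b f g \<mu> lam x)"
    unfolding C_star_def using minimizer_y_lam[OF assms, of x] assms
    by (intro INF_eq_value_at_minimizer) (auto simp: minimizer_def penalty_eq_objective)
  then show ?thesis using assms by (simp add: penalty_eq_objective)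
qed

text \<open>
  \<open>C\<^sup>\<star>\<close> is \<open>\<lambda>\<close> times the difference of the minimal values for \<open>s = 1/\<lambda>\<close> and \<open>s = 0\<close>, and the envelope theorem
  applies to each of them.
\<close>

lemma has_derivative_C_star:
  assumes "0 < lam" "admissible (1 / lam)"
  shows "(C_star A b f g \<mu> lam has_derivative
    (\<lambda>u. (lam *\<^sub>R ((gx x (y_lam A b f g \<mu> lam x) + (1 / lam) *\<^sub>R fx x (y_lam A b f g \<mu> lam x))
      - gx x (y_mu A b g \<mu> x))) \<bullet> u)) (at x)"
proof -
  have "admissible 0" using rho_pos by (simp add: admissible_def)
  note d0 = envelope_derivative[OF minimizer_y_mu this, of x]
  note d1 = envelope_derivative[OF minimizer_y_lam[OF assms(1)] assms(2), of x]
  have eq: "C_star A b f g \<mu> lam = (\<lambda>x. lam * (objective (1 / lam) x (y_lam A b f g \<mu> lam x) - objective 0 x (y_mu A b g \<mu> x)))"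
    using C_star_eq[OF assms(1)] by blast
  show ?thesis
    using assms(1) has_derivative_mult_right[OF has_derivative_diff[OF d1 d0], of lam]
    unfolding eq by (simp add: inner_diff_left inner_add_left algebra_simps)
qed

section \<open>Sensitivity in the penalty parameter\<close>

lemma convex_Yi: "convex Yi"
proof (rule convex_interior, rule convexI)
  fix y z :: "real^'n" and s t :: real
  assume *: "y \<in> Y" "z \<in> Y" "0 \<le> s" "0 \<le> t" "s + t = 1"
  have "sl (s *\<^sub>R y + t *\<^sub>R z) i = s * sl y i + t * sl z i" for i
  proof -
    have "b $ i = (s + t) * b $ i" using * by simp
    then show ?thesis by (simp add: slack_def algebra_simps)
  qed
  then show "s *\<^sub>R y + t *\<^sub>R z \<in> Y" using * by (simp add: feasible_iff_slack)
qed

lemma dikin_segment: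
  assumes c: "c \<in> Yi" and "c + d \<in> dikin A b r c" and "0 \<le> t" "t \<le> 1"
  shows "c + t *\<^sub>R d \<in> dikin A b r c"
proof -
  have "c + d \<in> Yi" "lnorm A b c d \<le> r" using assms by (auto simp: dikin_def)
  have "c + t *\<^sub>R d = (1 - t) *\<^sub>R c + t *\<^sub>R (c + d)" by (simp add: algebra_simps)
  then have "c + t *\<^sub>R d \<in> Yi" using convexD_alt[OF convex_Yi c \<open>c + d \<in> Yi\<close>, of t] assms by simp
  moreover have "lnorm A b c (t *\<^sub>R d) \<le> r"
  proof -
    have "t * lnorm A b c d \<le> lnorm A b c d"
      using assms lnorm_nonneg[OF c] by (intro mult_left_le_one_le) auto
    then show ?thesis using assms \<open>lnorm A b c d \<le> r\<close> by (simp add: lnorm_scaleR)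
  qed
  ultimately show ?thesis by (simp add: dikin_def)
qed

lemma has_derivative_hess_yy_f: "(fy x has_derivative hess_yy f x y) (at y)"
proof -
  have "grad (\<lambda>y'. f (x, y')) = fy x"
    using grad_y_eq_snd[OF diff_f] by (auto simp: fun_eq_iff grad_y_def)
  moreover have "((\<lambda>y'. snd (grad f (x, y'))) has_derivative (\<lambda>u. snd (hess f (x, y) (0, u)))) (at y)"
    by (intro has_derivative_snd has_derivative_partial_y has_derivative_hess C2_f)
  ultimately show ?thesis
    unfolding hess_yy_def hess_def by (auto simp flip: frechet_derivative_works intro: differentiableI)
qed

text \<open>
  Outside the interior \<open>\<psi>\<^sub>\<mu>\<close> need not be differentiable, so its gradient is known only on this open set. That
  suffices to identify the Hessian there.
\<close>

lemma has_derivative_hess_yy_psi: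
  assumes "y \<in> Yi"
  shows "((\<lambda>y. gy x y + \<mu> *\<^sub>R barrier_grad A b y) has_derivative hess_yy (psi A b g \<mu>) x y) (at y)"
proof -
  have grad: "grad (\<lambda>y'. psi A b g \<mu> (x, y')) z = gy x z + \<mu> *\<^sub>R barrier_grad A b z" if "z \<in> Yi" for z
  proof (rule has_derivative_imp_grad_eq)
    have "((\<lambda>y'. g (x, y') + \<mu> * barrier A b y') has_derivative (\<lambda>u. gy x z \<bullet> u + \<mu> * (barrier_grad A b z \<bullet> u))) (at z)"
      by (intro has_derivative_add has_derivative_mult_right has_derivative_partial_grad_y
          has_derivative_barrier diff_g that)
    then show "((\<lambda>y'. psi A b g \<mu> (x, y')) has_derivative (\<lambda>u. (gy x z + \<mu> *\<^sub>R barrier_grad A b z) \<bullet> u)) (at z)"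
      by (simp add: psi_def inner_add_left)
  qed
  have der: "((\<lambda>y. gy x y + \<mu> *\<^sub>R barrier_grad A b y) has_derivative
      (\<lambda>u. snd (hess g (x, y) (0, u)) + \<mu> *\<^sub>R H y u)) (at y)"
    by (intro has_derivative_add has_derivative_scaleR_right has_derivative_snd has_derivative_partial_y
        has_derivative_hess C2_g has_derivative_H assms)
  then have "(grad (\<lambda>y'. psi A b g \<mu> (x, y')) has_derivative
      (\<lambda>u. snd (hess g (x, y) (0, u)) + \<mu> *\<^sub>R H y u)) (at y)"
    by (rule has_derivative_transform_within_open[OF _ open_interior assms]) (simp add: grad)
  then have "hess_yy (psi A b g \<mu>) x y = (\<lambda>u. snd (hess g (x, y) (0, u)) + \<mu> *\<^sub>R H y u)"
    unfolding hess_yy_def hess_def by (rule frechet_derivative_at[symmetric])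
  then show ?thesis using der by simp
qed

text \<open>
  On the Dikin region the Hessian of \<open>\<psi>\<^sub>\<mu> + s2 f\<close> is at least \<open>\<rho>\<^sub>\<psi> - s2 \<ell>\<^sub>f\<^sub>,\<^sub>1 \<ge> \<rho>\<^sub>\<psi> / 2\<close> times \<open>H\<^sub>c\<close>, and
  the gradient of this function vanishes at \<open>y\<close> and equals \<open>(s2 - s1) \<nabla>\<^sub>y f\<close> at \<open>c\<close>. The segment from \<open>c\<close> to
  \<open>y\<close> stays in the region because the region is convex.
\<close>

lemma dikin_sensitivity_s:
  assumes lb: "local_bounds A b f g \<mu> \<rho>p lp1 lp2 Lf0 Lf1 Lf2 x c (dikin A b r c)"
    and st1: "stationary s1 x c" and st2: "stationary s2 x y" and y: "y \<in> dikin A b r c"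
    and "0 < \<rho>p" and s2: "0 \<le> s2" "s2 * Lf1 \<le> \<rho>p / 2"
  shows "lnorm A b c (y - c) \<le> 2 * Lf0 / \<rho>p * \<bar>s2 - s1\<bar>"
proof -
  have c: "c \<in> Yi" and yi: "y \<in> Yi" using st1 st2 by (auto simp: stationary_def)
  define u where "u = y - c"
  define d where "d = lnorm A b c u"
  have d0: "0 \<le> d" using c by (simp add: d_def lnorm_nonneg)
  have cT: "c \<in> dikin A b r c" using dikin_segment[OF c, of u r 0] y by (simp add: u_def)
  define h where "h z = (gy x z + \<mu> *\<^sub>R barrier_grad A b z) + s2 *\<^sub>R fy x z" for z
  define h' where "h' z w = hess_yy (psi A b g \<mu>) x z w + s2 *\<^sub>R hess_yy f x z w" for z w
  have seg: "c + t *\<^sub>R u \<in> dikin A b r c" if "0 \<le> t" "t \<le> 1" for t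
    using dikin_segment[OF c] y that by (simp add: u_def)
  have der: "((\<lambda>z. h z \<bullet> u) has_derivative (\<lambda>w. h' z w \<bullet> u)) (at z)" if "z \<in> Yi" for z
    unfolding h_def h'_def
    by (intro has_derivative_inner_left has_derivative_add has_derivative_scaleR_right
        has_derivative_hess_yy_psi has_derivative_hess_yy_f that)
  obtain t where t: "0 \<le> t" "t \<le> 1" "h (c + u) \<bullet> u - h c \<bullet> u = h' (c + t *\<^sub>R u) u \<bullet> u"
    using segment_mvt[of "\<lambda>z. h z \<bullet> u" "\<lambda>z w. h' z w \<bullet> u" c u] der seg
    by (auto simp: dikin_def)
  define z where "z = c + t *\<^sub>R u"
  have z: "z \<in> dikin A b r c" using seg t by (simp add: z_def)
  have psi_low: "\<rho>p * d\<^sup>2 \<le> hess_yy (psi A b g \<mu>) x z u \<bullet> u"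
    using lb z unfolding local_bounds_def d_def lnorm_power2[OF c] by blast
  have "\<bar>hess_yy f x z u \<bullet> u\<bar> \<le> opnorm_c A b c (hess_yy f x z) * d\<^sup>2"
    unfolding d_def
    by (rule opnorm_c_quadratic_form[OF c has_derivative_linear[OF has_derivative_hess_yy_f]])
  also have "\<dots> \<le> Lf1 * d\<^sup>2"
    using lb z unfolding local_bounds_def by (intro mult_right_mono) auto
  finally have "s2 * \<bar>hess_yy f x z u \<bullet> u\<bar> \<le> s2 * (Lf1 * d\<^sup>2)"
    using s2 by (intro mult_left_mono)
  also have "\<dots> = (s2 * Lf1) * d\<^sup>2" by simp
  also have "\<dots> \<le> \<rho>p / 2 * d\<^sup>2" using s2 by (intro mult_right_mono) auto
  finally have "- (\<rho>p / 2 * d\<^sup>2) \<le> s2 * (hess_yy f x z u \<bullet> u)"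
    using s2 by (smt (verit) abs_ge_minus_self minus_mult_right mult_left_mono)
  then have low: "\<rho>p / 2 * d\<^sup>2 \<le> h (c + u) \<bullet> u - h c \<bullet> u"
    using psi_low t(3) by (simp add: h'_def z_def inner_add_left)
  have "h (c + u) = 0" using st2 by (simp add: stationary_def h_def u_def add_ac)
  moreover have "h c = (s2 - s1) *\<^sub>R fy x c"
    using stationary_barrier_grad[OF st1] by (simp add: h_def algebra_simps)
  ultimately have "\<rho>p / 2 * d\<^sup>2 \<le> \<bar>s2 - s1\<bar> * \<bar>fy x c \<bullet> u\<bar>"
    using low abs_ge_minus_self[of "(s2 - s1) * (fy x c \<bullet> u)"] by (simp add: abs_mult)
  also have "\<dots> \<le> \<bar>s2 - s1\<bar> * (Lf0 * d)"
  proof (intro mult_left_mono)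
    have "\<bar>fy x c \<bullet> u\<bar> \<le> dnorm A b c (fy x c) * d"
      unfolding d_def by (rule inner_le_dnorm_lnorm[OF c])
    also have "\<dots> \<le> Lf0 * d"
      using lb cT d0 unfolding local_bounds_def
      by (intro mult_right_mono) (auto simp: grad_y_eq_snd[OF diff_f])
    finally show "\<bar>fy x c \<bullet> u\<bar> \<le> Lf0 * d" .
  qed auto
  finally have "(\<rho>p * d) * d \<le> (2 * Lf0 * \<bar>s2 - s1\<bar>) * d" by (simp add: power2_eq_square mult_ac)
  moreover have "0 \<le> Lf0"
    using lb cT dnorm_nonneg[OF c, of "grad_y f x c"] unfolding local_bounds_def by force
  ultimately have "\<rho>p * d \<le> 2 * Lf0 * \<bar>s2 - s1\<bar>"
    using d0 by (cases "d = 0") (auto simp: mult_le_cancel_right)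
  then show ?thesis
    using \<open>0 < \<rho>p\<close> by (simp add: d_def u_def pos_le_divide_eq mult_ac)
qed

lemma hypergradient_properties:
  assumes adm: "\<And>lam. lam0 \<le> lam \<Longrightarrow> admissible (1 / lam)" and lam0: "0 < lam0" "2 * s_rate \<le> lam0"
  shows "\<exists>LF cx. (\<forall>x. F_mu A b f g \<mu> differentiable (at x)) \<and>
       (\<forall>x1 x2. norm (grad (F_mu A b f g \<mu>) x2 - grad (F_mu A b f g \<mu>) x1) \<le> LF * norm (x2 - x1)) \<and>
       (\<forall>x. \<forall>lam\<ge>lam0. C_star A b f g \<mu> lam differentiable (at x) \<and>
          norm (grad (F_mu A b f g \<mu>) x - grad (C_star A b f g \<mu> lam) x) \<le> cx / lam)"
proof -
  define ym where "ym = y_mu A b g \<mu>"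
  have st: "stationary 0 x (ym x)" for x
    unfolding ym_def by (rule minimizer_imp_stationary[OF minimizer_y_mu])
  then have "\<exists>v. adjoint_state x (ym x) v" for x
    by (intro adjoint_state_exists) (simp add: stationary_def)
  then obtain v where v: "\<And>x. adjoint_state x (ym x) (v x)" by metis
  define G where "G x = hypergrad x (ym x) (v x)" for x
  obtain C where C: "\<And>x1 x2 y1 y2 v. stationary 0 x1 y1 \<Longrightarrow> stationary 0 x2 y2 \<Longrightarrow> adjoint_state x1 y1 v \<Longrightarrow>
      \<bar>f (x2, y2) - f (x1, y1) - hypergrad x1 y1 v \<bullet> (x2 - x1)\<bar> \<le> C * (norm (x2 - x1))\<^sup>2"
    using hyperobjective_quadratic_remainder by blast
  have rem: "\<bar>F_mu A b f g \<mu> x' - F_mu A b f g \<mu> x - G x \<bullet> (x' - x)\<bar> \<le> C * (norm (x' - x))\<^sup>2" for x x'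
    using C[OF st st v] by (simp add: F_mu_def G_def ym_def)
  have F: "(F_mu A b f g \<mu> has_derivative (\<lambda>u. G x \<bullet> u)) (at x)" for x
    by (rule quadratic_remainder_has_derivative[OF rem])
  then have grad_F: "grad (F_mu A b f g \<mu>) x = G x" for x by (rule has_derivative_imp_grad_eq)
  obtain c where c: "\<And>x y y' v lam. stationary 0 x y \<Longrightarrow> stationary (1 / lam) x y' \<Longrightarrow> admissible (1 / lam) \<Longrightarrow>
      0 < lam \<Longrightarrow> 2 * s_rate \<le> lam \<Longrightarrow> adjoint_state x y v \<Longrightarrow>
      norm (hypergrad x y v - lam *\<^sub>R ((gx x y' + (1 / lam) *\<^sub>R fx x y') - gx x y)) \<le> c / lam"
    using penalty_gradient_error by blast
  have "C_star A b f g \<mu> lam differentiable (at x) \<and>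
      norm (grad (F_mu A b f g \<mu>) x - grad (C_star A b f g \<mu> lam) x) \<le> c / lam" if "lam0 \<le> lam" for x lam
  proof -
    have pos: "0 < lam" "2 * s_rate \<le> lam" using that lam0 by auto
    note der = has_derivative_C_star[OF pos(1) adm[OF that], of x]
    show ?thesis
      using c[OF st minimizer_imp_stationary[OF minimizer_y_lam[OF pos(1)]] adm[OF that] pos v, of x]
      unfolding grad_F has_derivative_imp_grad_eq[OF der] G_def
      by (auto simp: ym_def intro: differentiableI[OF der])
  qed
  moreover have "norm (grad (F_mu A b f g \<mu>) x2 - grad (F_mu A b f g \<mu>) x1) \<le> 6 * C * norm (x2 - x1)" for x1 x2
    unfolding grad_F by (rule quadratic_remainder_lipschitz_gradient[OF rem])
  ultimately show ?thesis
    using F differentiableI by blast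
qed

text \<open>
  The intermediate point \<open>y\<close> has the new \<open>\<lambda>\<close> but the old \<open>x\<close>. It lies in the Dikin region of \<open>c\<close>, which gives
  the sharp constant for the first leg. The second leg is estimated at its own centre \<open>y\<close>, and
  the return to the centre \<open>c\<close> costs a factor \<open>1 + 2\<eta> \<le> 2\<close>.
\<close>

lemma y_lam_lipschitz:
  assumes dc: "dikin_constants A b f g \<mu> \<eta> \<rho>p lp1 lp2 Lf0 Lf1 Lf2 lame"
    and lam0: "0 < lam0" "lame \<le> lam0" "2 * Lf1 / \<rho>p \<le> lam0" "s_rate \<le> 2 * \<eta> * lam0"
    and "\<eta> < 1 / 2" and adm: "\<And>lam. lam0 \<le> lam \<Longrightarrow> admissible (1 / lam)"
    and lam1: "lam0 \<le> lam1" and lam2: "lam0 \<le> lam2"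
  shows "lnorm A b (y_lam A b f g \<mu> lam1 x1) (y_lam A b f g \<mu> lam2 x2 - y_lam A b f g \<mu> lam1 x1)
    \<le> 2 * Lf0 / \<rho>p * \<bar>1 / lam2 - 1 / lam1\<bar> + 2 * x_rate * norm (x2 - x1)"
proof -
  define c where "c = y_lam A b f g \<mu> lam1 x1"
  define y where "y = y_lam A b f g \<mu> lam2 x1"
  define y' where "y' = y_lam A b f g \<mu> lam2 x2"
  have pos: "0 < lam1" "0 < lam2" using lam0 lam1 lam2 by auto
  have st: "stationary (1 / lam1) x1 c" "stationary (1 / lam2) x1 y" "stationary (1 / lam2) x2 y'"
    unfolding c_def y_def y'_def using pos by (auto intro: minimizer_imp_stationary minimizer_y_lam)
  then have in_Yi: "c \<in> Yi" "y \<in> Yi" by (auto simp: stationary_def)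
  have rp: "0 < \<rho>p" using dc by (simp add: dikin_constants_def)
  have "\<bar>1 / lam2 - 1 / lam1\<bar> \<le> 1 / lam0"
  proof -
    have "1 / lam1 \<le> 1 / lam0" "1 / lam2 \<le> 1 / lam0" "0 < 1 / lam1" "0 < 1 / lam2"
      using lam0 lam1 lam2 pos by (auto intro: divide_left_mono)
    then show ?thesis by linarith
  qed
  then have "s_rate * \<bar>1 / lam2 - 1 / lam1\<bar> \<le> s_rate * (1 / lam0)"
    by (intro mult_left_mono s_rate_nonneg)
  also have "\<dots> \<le> 2 * \<eta>" using lam0 by (simp add: pos_divide_le_eq)
  finally have in_ball: "lnorm A b c (y - c) \<le> 2 * \<eta>"
    using stationary_lipschitz_s[OF st(1,2) adm[OF lam2]] by linarith
  have "lnorm A b c (y - c) \<le> 2 * Lf0 / \<rho>p * \<bar>1 / lam2 - 1 / lam1\<bar>"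
  proof (rule dikin_sensitivity_s[OF _ st(1,2) _ rp])
    show "local_bounds A b f g \<mu> \<rho>p lp1 lp2 Lf0 Lf1 Lf2 x1 c (dikin A b (2 * \<eta>) c)"
      using dc lam1 lam0 by (simp add: dikin_constants_def c_def)
    show "y \<in> dikin A b (2 * \<eta>) c" using in_ball in_Yi by (simp add: dikin_def)
    have "2 * Lf1 / \<rho>p \<le> lam2" using lam0 lam2 by linarith
    then show "1 / lam2 * Lf1 \<le> \<rho>p / 2" using rp pos by (simp add: field_simps)
  qed (use pos in auto)
  moreover have "lnorm A b c (y' - y) \<le> 2 * x_rate * norm (x2 - x1)"
  proof -
    have "lnorm A b c (y' - y) \<le> (1 + lnorm A b c (y - c)) * lnorm A b y (y' - y)"
      by (rule lnorm_change_center[OF in_Yi])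
    also have "\<dots> \<le> 2 * (x_rate * norm (x2 - x1))"
    proof (intro mult_mono)
      show "1 + lnorm A b c (y - c) \<le> 2" using in_ball \<open>\<eta> < 1 / 2\<close> by linarith
      show "lnorm A b y (y' - y) \<le> x_rate * norm (x2 - x1)"
        by (rule stationary_lipschitz_x[OF st(2,3) adm[OF lam2]])
    qed (auto simp: lnorm_nonneg in_Yi)
    finally show ?thesis by simp
  qed
  moreover have "lnorm A b c (y' - c) \<le> lnorm A b c (y - c) + lnorm A b c (y' - y)"
    using lnorm_triangle[OF in_Yi(1), of "y - c" "y' - y"] by simp
  ultimately show ?thesis by (simp add: c_def y'_def)
qed

end

section \<open>Regularity of the barrier-smoothed bilevel problem\<close>

theorem proposition2:
  fixes A :: "real^'dy^'m" and b :: "real^'m"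
    and \<mu> \<eta> lf0 lf1 lf2 lg0 lg1 lg2 \<rho>g :: real
  assumes "compact (feasible A b)" and "interior (feasible A b) \<noteq> {}"
    and "\<mu> > 0" and "0 < \<eta>" and "\<eta> < 1 / 2"
  shows "\<exists>\<Lambda>>0. \<forall>(f :: (real^'dx) \<times> (real^'dy) \<Rightarrow> real) (g :: (real^'dx) \<times> (real^'dy) \<Rightarrow> real)
      \<rho>p lp1 lp2 Lf0 Lf1 Lf2 lame lam0.
    objective_regular lf0 lf1 lf2 lg0 lg1 lg2 \<rho>g f g \<longrightarrow>
    bdd_below (range (\<lambda>x. f (x, y_star A b g x))) \<longrightarrow>
    dikin_constants A b f g \<mu> \<eta> \<rho>p lp1 lp2 Lf0 Lf1 Lf2 lame \<longrightarrow>
    \<Lambda> \<le> lame \<longrightarrow>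
    max lame (2 * Lf1 / \<rho>p) \<le> lam0 \<longrightarrow>
    (\<exists>ls0 ll0 LF cx :: real.
       (\<forall>x1 x2. \<forall>lam1\<ge>lam0. \<forall>lam2\<ge>lam0.
          lnorm A b (y_lam A b f g \<mu> lam1 x1) (y_lam A b f g \<mu> lam2 x2 - y_lam A b f g \<mu> lam1 x1)
            \<le> 2 * Lf0 / \<rho>p * \<bar>1 / lam2 - 1 / lam1\<bar> + ll0 * norm (x2 - x1)) \<and>
       (\<forall>x1 x2.
          lnorm A b (y_mu A b g \<mu> x1) (y_mu A b g \<mu> x2 - y_mu A b g \<mu> x1)
            \<le> ls0 * norm (x2 - x1)) \<and>
       (\<forall>x. F_mu A b f g \<mu> differentiable (at x)) \<and>
       (\<forall>x1 x2. norm (grad (F_mu A b f g \<mu>) x2 - grad (F_mu A b f g \<mu>) x1)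
            \<le> LF * norm (x2 - x1)) \<and>
       (\<forall>x. \<forall>lam\<ge>lam0. C_star A b f g \<mu> lam differentiable (at x) \<and>
          norm (grad (F_mu A b f g \<mu>) x - grad (C_star A b f g \<mu> lam) x) \<le> cx / lam))"
proof -
  \<comment> \<open>\<open>S\<close> is the Lipschitz constant \<open>s_rate\<close> of the minimizers in \<open>s\<close>, written without \<open>f\<close> and \<open>g\<close>\<close>
  define S where "S = 2 * diameter (feasible A b) / \<mu> * lf0"
  \<comment> \<open>the entries ensure, for \<open>\<lambda> \<ge> \<Lambda>\<close>: \<open>\<lambda> > 0\<close>; admissibility of \<open>1/\<lambda>\<close>;
    local distance at most \<open>1/2\<close> between \<open>y\<^sub>\<lambda>\<close> and \<open>y\<^sub>\<mu>\<close>;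
    local distance at most \<open>2\<eta>\<close> between two points \<open>y\<^sub>\<lambda>\<close>\<close>
  define \<Lambda> where "\<Lambda> = max 1 (max (lf1 / \<rho>g) (max (2 * S) (S / (2 * \<eta>))))"
  have Lam: "1 \<le> \<Lambda>" "lf1 / \<rho>g \<le> \<Lambda>" "2 * S \<le> \<Lambda>" "S / (2 * \<eta>) \<le> \<Lambda>"
    by (auto simp: \<Lambda>_def)
  show ?thesis
  proof (rule exI[of _ \<Lambda>], intro conjI allI impI)
    show "0 < \<Lambda>" using Lam by linarith
    fix f g :: "(real^'dx) \<times> (real^'dy) \<Rightarrow> real" and \<rho>p lp1 lp2 Lf0 Lf1 Lf2 lame lam0 :: real
    assume reg: "objective_regular lf0 lf1 lf2 lg0 lg1 lg2 \<rho>g f g"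
      and dc: "dikin_constants A b f g \<mu> \<eta> \<rho>p lp1 lp2 Lf0 Lf1 Lf2 lame"
      and lame: "\<Lambda> \<le> lame" and lam0: "max lame (2 * Lf1 / \<rho>p) \<le> lam0"
    interpret bilevel_barrier A b f g \<mu> lf0 lf1 lf2 lg0 lg1 lg2 \<rho>g
      using assms reg by unfold_locales
    have S: "s_rate = S" by (simp add: s_rate_def S_def)
    have L0: "\<Lambda> \<le> lam0" "0 < lam0" using lame lam0 Lam by auto
    have adm: "admissible (1 / lam)" if "lam0 \<le> lam" for lam
    proof -
      have "lf1 / \<rho>g \<le> lam" "0 < lam" using that L0 Lam by auto
      then show ?thesis using rho_pos by (simp add: admissible_def field_simps)
    qed
    have eta: "s_rate \<le> 2 * \<eta> * lam0"
      using Lam(4) L0 \<open>0 < \<eta>\<close> by (simp add: S pos_divide_le_eq mult.commute order_trans)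
    obtain LF cx where grads:
      "\<forall>x. F_mu A b f g \<mu> differentiable (at x)"
      "\<forall>x1 x2. norm (grad (F_mu A b f g \<mu>) x2 - grad (F_mu A b f g \<mu>) x1) \<le> LF * norm (x2 - x1)"
      "\<forall>x. \<forall>lam\<ge>lam0. C_star A b f g \<mu> lam differentiable (at x) \<and>
          norm (grad (F_mu A b f g \<mu>) x - grad (C_star A b f g \<mu> lam) x) \<le> cx / lam"
      using hypergradient_properties[OF adm, of lam0] L0 Lam by (auto simp: S)
    have "admissible 0" using rho_pos by (simp add: admissible_def)
    then have lip_mu: "\<forall>x1 x2. lnorm A b (y_mu A b g \<mu> x1) (y_mu A b g \<mu> x2 - y_mu A b g \<mu> x1)
            \<le> x_rate * norm (x2 - x1)"
      using stationary_lipschitz_x minimizer_imp_stationary[OF minimizer_y_mu] by blast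
    have lip_lam: "\<forall>x1 x2. \<forall>lam1\<ge>lam0. \<forall>lam2\<ge>lam0.
          lnorm A b (y_lam A b f g \<mu> lam1 x1) (y_lam A b f g \<mu> lam2 x2 - y_lam A b f g \<mu> lam1 x1)
            \<le> 2 * Lf0 / \<rho>p * \<bar>1 / lam2 - 1 / lam1\<bar> + 2 * x_rate * norm (x2 - x1)"
      using y_lam_lipschitz[OF dc L0(2) _ _ eta \<open>\<eta> < 1 / 2\<close> adm] lam0 by simp
    show "\<exists>ls0 ll0 LF cx :: real.
       (\<forall>x1 x2. \<forall>lam1\<ge>lam0. \<forall>lam2\<ge>lam0.
          lnorm A b (y_lam A b f g \<mu> lam1 x1) (y_lam A b f g \<mu> lam2 x2 - y_lam A b f g \<mu> lam1 x1)
            \<le> 2 * Lf0 / \<rho>p * \<bar>1 / lam2 - 1 / lam1\<bar> + ll0 * norm (x2 - x1)) \<and>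
       (\<forall>x1 x2.
          lnorm A b (y_mu A b g \<mu> x1) (y_mu A b g \<mu> x2 - y_mu A b g \<mu> x1)
            \<le> ls0 * norm (x2 - x1)) \<and>
       (\<forall>x. F_mu A b f g \<mu> differentiable (at x)) \<and>
       (\<forall>x1 x2. norm (grad (F_mu A b f g \<mu>) x2 - grad (F_mu A b f g \<mu>) x1)
            \<le> LF * norm (x2 - x1)) \<and>
       (\<forall>x. \<forall>lam\<ge>lam0. C_star A b f g \<mu> lam differentiable (at x) \<and>
          norm (grad (F_mu A b f g \<mu>) x - grad (C_star A b f g \<mu> lam) x) \<le> cx / lam)"
      using lip_lam lip_mu grads by blast
  qed
qed

end
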